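(* Let $I=(0,1)$ or $I=(0,\infty)$, and let $E$ and $F$ be quasi-Banach ideal spaces on $I$ such that $E^{( * )}\neq\{0\}$ and $F^{( * )}\neq\{0\}$. If the operator $D_2$ is bounded both on $E^{\downarrow}$ and on $F^{\downarrow}$ (with best constants $A_E$, $A_F$), then $E^{( * )}\odot F^{( * )}\neq\{0\}$, $E^{( * )}\odot F^{( * )}\subset(E\odot F)^{( * )}$ and $$\|x\|_{(E\odot F)^{( * )}}\le C_1^2\,\|x\|_{E^{( * )}\odot F^{( * )}}\quad\text{for all }x\in E^{( * )}\odot F^{( * )},$$ where $C_1\le\max(A_E,A_F)$ is a constant with $\|x\|_{(E^{1/2}F^{1/2})^{( * )}}\le C_1\|x\|_{(E^{( * )})^{1/2}(F^{( * )})^{1/2}}$ for all $x\in(E^{( * )})^{1/2}(F^{( * )})^{1/2}$. If, additionally, for some $r>0$ the operator $H_r^*$ is bounded on the spaces $E$ and $F$, then $(E\odot F)^{( * )}\subset E^{( * )}\odot F^{( * )}$ and $$\|x\|_{E^{( * )}\odot F^{( * )}}\le C_2^2\,\|x\|_{(E\odot F)^{( * )}}\quad\text{for all }x\in(E\odot F)^{( * )},$$ where $C_2\le2^{1/r}\max(1,2^{1/r-1})\cdot\max\left(A_E\|H_r^*\|_{E\to E},A_F\|H_r^*\|_{F\to F}\right)$ is a constant with $\|x\|_{(E^{( * )})^{1/2}(F^{( * )})^{1/2}}\le C_2\|x\|_{(E^{1/2}F^{1/2})^{( * )}}$ for all $x\in(E^{1/2}F^{1/2})^{( * )}$. In particular,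 in this case the functional $\|\cdot\|_{(E\odot F)^{( * )}}$ is a quasi-norm on $(E\odot F)^{( * )}$, and $(E\odot F)^{( * )}=E^{( * )}\odot F^{( * )}$ (equal as sets, with equivalent quasi-norms).
   Context: $I=(0,1)$ or $(0,\infty)$ with Lebesgue measure $m$; $L^0(I)$ is the space of (classes of) real measurable functions on $I$. A quasi-normed ideal space $E$ on $I$ is a linear subspace of $L^0(I)$ with a quasi-norm such that $y\in E$, $x\in L^0$, $|x|\le|y|$ a.e. imply $x\in E$ and $\|x\|_E\le\|y\|_E$; it is a quasi-Banach ideal space if complete. Such spaces are always assumed to have a weak unit (an element positive a.e. on $I$). $x^*(t)=\inf\{\lambda>0: m\{|x|>\lambda\}\le t\}$ is the nonincreasing rearrangement. The symmetrization of $E$ is $E^{( * )}=\{x\in L^0(I):x^*\in E\}$ with functional $\|x\|_{E^{( * )}}=\|x^*\|_E$. $E^{\downarrow}$ is the cone of all $x\in E$ with $x=x^*$. Dilation operator: $D_2x(t)=x(t/2)$, $t\in I$. "$D_2$ is bounded on $E^{\downarrow}$" means that there is a constant $1\le A<\infty$ with $\|D_2x\|_E\le A\|x\|_E$ for all $x\in E^{\downarrow}$; $A_E$ is the smallest such $A$. (Under this condition $E^{( * )}$ is a quasi-normed ideal space.) For $r>0$ and $l=m(I)$: $H_r^*x(t)=\left(\int_t^l\frac{|x(s)|^r}{s}\,ds\right)^{1/r}$. It is bounded on $E$ if there is $C$ with $H_r^*x\in E$ and $\|H_r^*x\|_E\le C\|x\|_E$ for all $x\in E$; $\|H_r^*\|_{E\to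 E}$ is the least such $C$. Product space: $E\odot F=\{xy:x\in E,y\in F\}$ with $\|u\|_{E\odot F}=\inf\{\|x\|_E\|y\|_F:u=xy,\,x\in E,\,y\in F\}$. Calderón product: $E^{1/2}F^{1/2}$ is the set of $x\in L^0(I)$ with $|x|\le\lambda|x_0|^{1/2}|x_1|^{1/2}$ a.e. for some $\lambda>0$, $x_0\in E$, $x_1\in F$ with $\|x_0\|_E\le1$, $\|x_1\|_F\le1$; its quasi-norm is the infimum of such $\lambda$. *)

theory Defs
  imports "HOL-Analysis.Analysis"
begin

text \<open>
  Elements of $L^0(I)$ are represented by functions on the reals that are Lebesgue measurable on
  \<open>I\<close>; values outside \<open>I\<close> never matter. A space of classes is modelled by the set of all
  representatives of its members, and equality of classes is equality a.e. on \<open>I\<close>.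
\<close>

abbreviation L0 :: "real set \<Rightarrow> (real \<Rightarrow> real) set" where
  "L0 I \<equiv> borel_measurable (lebesgue_on I)"

definition null_class :: "real set \<Rightarrow> (real \<Rightarrow> real) set" where
  "null_class I = {x \<in> L0 I. AE t in lebesgue_on I. x t = 0}"

record fspace =
  elems :: "(real \<Rightarrow> real) set"
  qnorm :: "(real \<Rightarrow> real) \<Rightarrow> real"

text \<open>The second conjunct says that membership and quasi-norm depend only on the class.\<close>

definition quasi_normed_space :: "real set \<Rightarrow> fspace \<Rightarrow> bool" where
  "quasi_normed_space I E \<longleftrightarrow>
     elems E \<subseteq> L0 I \<and>
     (\<forall>x\<in>elems E. \<forall>y\<in>L0 I. (AE t in lebesgue_on I. y t = x t) \<longrightarrow>
        y \<in> elems E \<and> qnorm E y = qnorm E x) \<and>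
     (\<lambda>t. 0) \<in> elems E \<and>
     (\<forall>x\<in>elems E. \<forall>y\<in>elems E. (\<lambda>t. x t + y t) \<in> elems E) \<and>
     (\<forall>a. \<forall>x\<in>elems E. (\<lambda>t. a * x t) \<in> elems E) \<and>
     (\<forall>x\<in>elems E. 0 \<le> qnorm E x) \<and>
     (\<forall>x\<in>elems E. qnorm E x = 0 \<longleftrightarrow> (AE t in lebesgue_on I. x t = 0)) \<and>
     (\<forall>a. \<forall>x\<in>elems E. qnorm E (\<lambda>t. a * x t) = \<bar>a\<bar> * qnorm E x) \<and>
     (\<exists>K\<ge>1. \<forall>x\<in>elems E. \<forall>y\<in>elems E. qnorm E (\<lambda>t. x t + y t) \<le> K * (qnorm E x + qnorm E y))"

definition quasi_normed_ideal_space :: "real set \<Rightarrow> fspace \<Rightarrow> bool" where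
  "quasi_normed_ideal_space I E \<longleftrightarrow>
     quasi_normed_space I E \<and>
     (\<forall>y\<in>elems E. \<forall>x\<in>L0 I. (AE t in lebesgue_on I. \<bar>x t\<bar> \<le> \<bar>y t\<bar>) \<longrightarrow>
        x \<in> elems E \<and> qnorm E x \<le> qnorm E y) \<and>
     (\<exists>w\<in>elems E. AE t in lebesgue_on I. 0 < w t)"

definition quasi_Banach_ideal_space :: "real set \<Rightarrow> fspace \<Rightarrow> bool" where
  "quasi_Banach_ideal_space I E \<longleftrightarrow>
     quasi_normed_ideal_space I E \<and>
     (\<forall>u :: nat \<Rightarrow> real \<Rightarrow> real.
        (\<forall>n. u n \<in> elems E) \<and>
        (\<forall>e>0. \<exists>N. \<forall>m\<ge>N. \<forall>n\<ge>N. qnorm E (\<lambda>t. u m t - u n t) < e) \<longrightarrow>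
        (\<exists>x\<in>elems E. (\<lambda>n. qnorm E (\<lambda>t. u n t - x t)) \<longlonglongrightarrow> 0))"

text \<open>
  The rearrangement is extended-real valued: on $(0,\infty)$ the set of admissible levels may be
  empty, and then $x^*(t) = \infty$ and $x^*$ belongs to no space of real functions.
\<close>

definition rearrangement :: "real set \<Rightarrow> (real \<Rightarrow> real) \<Rightarrow> real \<Rightarrow> ereal" where
  "rearrangement I x t =
     (INF c\<in>{c::real. 0 < c \<and> emeasure (lebesgue_on I) {s\<in>I. c < \<bar>x s\<bar>} \<le> ennreal t}. ereal c)"

definition rearr :: "real set \<Rightarrow> (real \<Rightarrow> real) \<Rightarrow> real \<Rightarrow> real" where
  "rearr I x t = real_of_ereal (rearrangement I x t)"

definition symmetrization :: "real set \<Rightarrow> fspace \<Rightarrow> fspace" where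
  "symmetrization I E =
     \<lparr> elems = {x \<in> L0 I. (AE t in lebesgue_on I. rearrangement I x t < \<infinity>) \<and> rearr I x \<in> elems E},
       qnorm = (\<lambda>x. qnorm E (rearr I x)) \<rparr>"

definition decreasing_cone :: "real set \<Rightarrow> fspace \<Rightarrow> (real \<Rightarrow> real) set" where
  "decreasing_cone I E = {x \<in> elems E. AE t in lebesgue_on I. ereal (x t) = rearrangement I x t}"

definition D2 :: "(real \<Rightarrow> real) \<Rightarrow> real \<Rightarrow> real" where
  "D2 x t = x (t / 2)"

definition D2_bound :: "real set \<Rightarrow> fspace \<Rightarrow> real \<Rightarrow> bool" where
  "D2_bound I E A \<longleftrightarrow>
     1 \<le> A \<and> (\<forall>x\<in>decreasing_cone I E. D2 x \<in> elems E \<and> qnorm E (D2 x) \<le> A * qnorm E x)"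

definition D2_bounded :: "real set \<Rightarrow> fspace \<Rightarrow> bool" where
  "D2_bounded I E \<longleftrightarrow> (\<exists>A. D2_bound I E A)"

definition D2_const :: "real set \<Rightarrow> fspace \<Rightarrow> real" where
  "D2_const I E = Inf {A. D2_bound I E A}"

text \<open>
  \<open>hardy_integral\<close> is the integral under the root in $H_r^* x(t)$, possibly infinite;
  \<open>hardy\<close> agrees with $H_r^* x$ wherever it is finite.
\<close>

definition hardy_integral :: "real set \<Rightarrow> real \<Rightarrow> (real \<Rightarrow> real) \<Rightarrow> real \<Rightarrow> ennreal" where
  "hardy_integral I r x t =
     (\<integral>\<^sup>+ s. ennreal (\<bar>x s\<bar> powr r / s) \<partial>lebesgue_on (I \<inter> {t<..}))"

definition hardy :: "real set \<Rightarrow> real \<Rightarrow> (real \<Rightarrow> real) \<Rightarrow> real \<Rightarrow> real" where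
  "hardy I r x t = enn2real (hardy_integral I r x t) powr (1 / r)"

definition hardy_bound :: "real set \<Rightarrow> real \<Rightarrow> fspace \<Rightarrow> real \<Rightarrow> bool" where
  "hardy_bound I r E C \<longleftrightarrow>
     0 \<le> C \<and>
     (\<forall>x\<in>elems E. (AE t in lebesgue_on I. hardy_integral I r x t < \<infinity>) \<and>
        hardy I r x \<in> elems E \<and> qnorm E (hardy I r x) \<le> C * qnorm E x)"

definition hardy_bounded :: "real set \<Rightarrow> real \<Rightarrow> fspace \<Rightarrow> bool" where
  "hardy_bounded I r E \<longleftrightarrow> (\<exists>C. hardy_bound I r E C)"

definition hardy_norm :: "real set \<Rightarrow> real \<Rightarrow> fspace \<Rightarrow> real" where
  "hardy_norm I r E = Inf {C. hardy_bound I r E C}"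

definition product_space :: "real set \<Rightarrow> fspace \<Rightarrow> fspace \<Rightarrow> fspace" where
  "product_space I E F =
     \<lparr> elems = {u \<in> L0 I. \<exists>x\<in>elems E. \<exists>y\<in>elems F. AE t in lebesgue_on I. u t = x t * y t},
       qnorm = (\<lambda>u. Inf {qnorm E x * qnorm F y | x y.
         x \<in> elems E \<and> y \<in> elems F \<and> (AE t in lebesgue_on I. u t = x t * y t)}) \<rparr>"

definition calderon_levels :: "real set \<Rightarrow> fspace \<Rightarrow> fspace \<Rightarrow> (real \<Rightarrow> real) \<Rightarrow> real set" where
  "calderon_levels I E F x =
     {c. 0 < c \<and> (\<exists>x0\<in>elems E. \<exists>x1\<in>elems F. qnorm E x0 \<le> 1 \<and> qnorm F x1 \<le> 1 \<and>
        (AE t in lebesgue_on I. \<bar>x t\<bar> \<le> c * (sqrt \<bar>x0 t\<bar> * sqrt \<bar>x1 t\<bar>)))}"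

text \<open>The Calderon product $E^{1/2}F^{1/2}$; its quasi-norm is the infimum of the admissible $\lambda$.\<close>

definition calderon_half :: "real set \<Rightarrow> fspace \<Rightarrow> fspace \<Rightarrow> fspace" where
  "calderon_half I E F =
     \<lparr> elems = {x \<in> L0 I. calderon_levels I E F x \<noteq> {}},
       qnorm = (\<lambda>x. Inf (calderon_levels I E F x)) \<rparr>"

definition embeds_with :: "fspace \<Rightarrow> fspace \<Rightarrow> real \<Rightarrow> bool" where
  "embeds_with X Y C \<longleftrightarrow>
     elems X \<subseteq> elems Y \<and> (\<forall>x\<in>elems X. qnorm Y x \<le> C * qnorm X x)"

definition equal_with_equivalent_qnorms :: "fspace \<Rightarrow> fspace \<Rightarrow> bool" where
  "equal_with_equivalent_qnorms X Y \<longleftrightarrow>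
     elems X = elems Y \<and>
     (\<exists>a>0. \<exists>b>0. \<forall>x\<in>elems X. a * qnorm X x \<le> qnorm Y x \<and> qnorm Y x \<le> b * qnorm X x)"

end

theory Submission
  imports Defs
begin

text \<open>
  Both inclusions are proved for products and then transferred to Calderon products, since
  \<open>x \<in> E\<^sup>1\<^sup>/\<^sup>2F\<^sup>1\<^sup>/\<^sup>2\<close> iff \<open>x\<^sup>2 \<in> E \<odot> F\<close>, with quasi-norm \<open>\<parallel>x\<^sup>2\<parallel>\<^sup>1\<^sup>/\<^sup>2\<close>, and squaring commutes with rearranging.

  The first inclusion is \<open>(xy)\<^sup>* \<le> D\<^sub>2x\<^sup>* D\<^sub>2y\<^sup>*\<close>. For the second, let \<open>u\<^sup>* = xy\<close>. As \<open>u\<^sup>*\<close> decreases,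
  integrating its power \<open>r/2\<close> against \<open>ds/s\<close> over \<open>(t/2, t)\<close> and the Cauchy-Schwarz inequality give
  \<open>u\<^sup>* \<le> 4\<^sup>1\<^sup>/\<^sup>r D\<^sub>2H\<^sub>r\<^sup>*x D\<^sub>2H\<^sub>r\<^sup>*y\<close> with both factors decreasing; these are then transplanted to functions
  of \<open>\<bar>u\<bar>\<close> whose product dominates \<open>\<bar>u\<bar>\<close>. The triangle inequality of \<open>(E \<odot> F)\<^sup>(\<^sup>*\<^sup>)\<close> is inherited
  from \<open>E\<^sup>(\<^sup>*\<^sup>) \<odot> F\<^sup>(\<^sup>*\<^sup>)\<close>; only the definiteness of \<open>E \<odot> F\<close> needs completeness, by which a sequence
  tending to zero fast enough in quasi-norm tends to zero almost everywhere.
\<close>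

section \<open>Rearrangements\<close>

text \<open>The second inclusion is the hard one: the factors of a decreasing function need not be
  decreasing, while \<open>D2_bound\<close> controls decreasing functions only, and membership in E
  does not pass to rearrangements. The Hardy operator repairs this, since its values are decreasing
  whatever the argument is and its boundedness keeps them in E. The exponent r/2 lets Cauchy-Schwarz
  split the product into two integrals of r-th powers, for every positive r; that these integrals
  start at t/2 is the source of the dilation. The same obstacle blocks a direct triangle inequality
  for the symmetrized product, which would call for a dilation bound on the product itself. The
  infimum in the product quasi-norm need not be attained, so estimates are made for every number
  above it, with a factorization whose two factors obey the same bound. This balance makes squaring
  match the Calderon levels exactly, and it makes both factors small in the definiteness
  argument.\<close>

locale half_line_interval =
  fixes I :: "real set"
  assumes I_cases: "I = {0<..<1} \<or> I = {0<..}"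
begin

lemma I_pos: "t \<in> I \<Longrightarrow> 0 < t"
  using I_cases by auto

lemma I_down: "t \<in> I \<Longrightarrow> 0 < s \<Longrightarrow> s \<le> t \<Longrightarrow> s \<in> I"
  using I_cases by auto

lemma I_half: "t \<in> I \<Longrightarrow> t / 2 \<in> I"
  using I_cases by auto

lemma I_open: "open I"
  using I_cases by auto

lemma I_sets [measurable, simp]: "I \<in> sets lebesgue"
  using I_cases by auto

lemma I_above: "t \<in> I \<Longrightarrow> \<exists>u\<in>I. t < u"
  using I_cases
proof
  assume "t \<in> I" "I = {0<..<1}"
  then show ?thesis using dense[of t 1] by auto
next
  assume "t \<in> I" "I = {0<..}"
  then show ?thesis by (intro bexI[of _ "t + 1"]) auto
qed

lemma I_below: "\<exists>t\<in>I. t \<le> e" if "0 < e"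
  using that I_cases by (auto intro!: bexI[of _ "min e (1/2)"])

lemma emeasure_interval:
  assumes "t \<in> I"
  shows "emeasure (lebesgue_on I) {0<..<t} = ennreal t" "{0<..<t} \<in> sets (lebesgue_on I)"
proof -
  have "{0<..<t} \<subseteq> I" using assms I_down[OF assms] by auto
  then show "emeasure (lebesgue_on I) {0<..<t} = ennreal t"
    using I_pos[OF assms] by (simp add: emeasure_restrict_space)
  show "{0<..<t} \<in> sets (lebesgue_on I)"
    using \<open>{0<..<t} \<subseteq> I\<close> by (simp add: sets_restrict_space_iff)
qed

lemma superlevel_sets [measurable]:
  assumes [measurable]: "x \<in> L0 I"
  shows "{s \<in> I. c < \<bar>x s\<bar>} \<in> sets (lebesgue_on I)"
proof -
  have "{s \<in> space (lebesgue_on I). c < \<bar>x s\<bar>} \<in> sets (lebesgue_on I)" by measurable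
  then show ?thesis by simp
qed

lemma rearrangement_nonneg: "0 \<le> rearrangement I x t"
  unfolding rearrangement_def by (auto intro!: INF_greatest)

text \<open>Right continuity of the distribution function: \<open>{d < \<bar>x\<bar>}\<close> is the
  increasing union of the sets above the levels \<open>d + 1 / Suc n\<close>, so the admissible
  levels contain their positive infimum. Most later estimates of rearrangements become comparisons
  of level sets through this equivalence.\<close>

lemma rearrangement_le_iff:
  assumes x: "x \<in> L0 I" and d: "0 \<le> d"
  shows "rearrangement I x t \<le> ereal d \<longleftrightarrow> emeasure (lebesgue_on I) {s\<in>I. d < \<bar>x s\<bar>} \<le> ennreal t"
proof
  assume *: "emeasure (lebesgue_on I) {s\<in>I. d < \<bar>x s\<bar>} \<le> ennreal t"
  show "rearrangement I x t \<le> ereal d"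
  proof (rule ereal_le_epsilon2)
    fix e :: real assume e: "0 < e"
    have "emeasure (lebesgue_on I) {s\<in>I. d + e < \<bar>x s\<bar>} \<le> emeasure (lebesgue_on I) {s\<in>I. d < \<bar>x s\<bar>}"
      using e by (intro emeasure_mono superlevel_sets x) auto
    \<comment> \<open>The level is \<open>d + e\<close> rather than \<open>d\<close> because
      admissible levels are strictly positive, whereas \<open>d\<close> may be 0.\<close>
    with * e d show "rearrangement I x t \<le> ereal d + ereal e"
      unfolding rearrangement_def by (intro INF_lower2[of "d + e"]) auto
  qed
next
  assume *: "rearrangement I x t \<le> ereal d"
  define A where "A n = {s\<in>I. d + 1 / Suc n < \<bar>x s\<bar>}" for n
  have "emeasure (lebesgue_on I) (A n) \<le> ennreal t" for n
  proof -
    have "rearrangement I x t < ereal (d + 1 / Suc n)"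
      using * by (rule order_le_less_trans) simp
    then obtain c where c: "c < d + 1 / Suc n" "emeasure (lebesgue_on I) {s\<in>I. c < \<bar>x s\<bar>} \<le> ennreal t"
      unfolding rearrangement_def INF_less_iff by auto
    have "emeasure (lebesgue_on I) (A n) \<le> emeasure (lebesgue_on I) {s\<in>I. c < \<bar>x s\<bar>}"
      unfolding A_def using c by (intro emeasure_mono superlevel_sets x) auto
    with c show ?thesis by simp
  qed
  moreover have "{s\<in>I. d < \<bar>x s\<bar>} = (\<Union>n. A n)"
  proof -
    have "\<exists>n. d + 1 / Suc n < a" if da: "d < a" for a :: real
    proof -
      obtain n where "1 / Suc n < a - d"
        using nat_approx_posE[of "a - d"] da by auto
      then show ?thesis by (intro exI[of _ n]) simp
    qed
    moreover have "d < a" if "d + 1 / Suc n < a" for a n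
      by (rule less_trans[OF _ that]) simp
    ultimately show ?thesis unfolding A_def by blast
  qed
  moreover have "(SUP n. emeasure (lebesgue_on I) (A n)) = emeasure (lebesgue_on I) (\<Union>n. A n)"
  proof (rule SUP_emeasure_incseq)
    show "range A \<subseteq> sets (lebesgue_on I)"
      unfolding A_def using superlevel_sets[OF x] by auto
    show "incseq A"
      unfolding A_def
    proof (intro incseq_SucI subsetI CollectI conjI; clarsimp)
      fix n s assume "d + 1 / (1 + real n) < \<bar>x s\<bar>"
      then show "d + 1 / (2 + real n) < \<bar>x s\<bar>"
        by (rule order_le_less_trans[rotated]) (simp add: frac_le)
    qed
  qed
  ultimately show "emeasure (lebesgue_on I) {s\<in>I. d < \<bar>x s\<bar>} \<le> ennreal t"
    by (metis (mono_tags, lifting) SUP_least)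
qed

lemma rearrangement_rearr:
  "rearrangement I x t < \<infinity> \<Longrightarrow> rearrangement I x t = ereal (rearr I x t)"
  using rearrangement_nonneg[of x t] unfolding rearr_def by (cases "rearrangement I x t") auto

lemma rearr_nonneg [simp]: "0 \<le> rearr I x t"
  unfolding rearr_def using rearrangement_nonneg by (rule real_of_ereal_pos)

lemma rearrangement_antimono: "s \<le> t \<Longrightarrow> rearrangement I x t \<le> rearrangement I x s"
  unfolding rearrangement_def
  by (rule INF_superset_mono) (auto intro: order_trans simp: ennreal_leI)

lemma AE_I_iff: "(AE t in lebesgue_on I. Q t) \<longleftrightarrow> (AE t in lebesgue. t \<in> I \<longrightarrow> Q t)"
  by (simp add: AE_restrict_space_iff)

text \<open>An initial interval has positive measure, so it cannot be contained in a null set. For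
  monotone quantities this upgrades finiteness almost everywhere to finiteness at every point of
  I.\<close>

lemma AE_I_ex_below:
  assumes "AE t in lebesgue_on I. Q t" "t \<in> I"
  shows "\<exists>s. 0 < s \<and> s < t \<and> Q s"
proof (rule ccontr)
  assume *: "\<not> ?thesis"
  obtain N where N: "N \<in> null_sets (lebesgue_on I)" "{s\<in>I. \<not> Q s} \<subseteq> N"
    using assms(1) by (auto simp: eventually_ae_filter)
  have "{0<..<t} \<subseteq> N" using * N I_down[OF assms(2)] by force
  then have "{0<..<t} \<in> null_sets (lebesgue_on I)"
    using N(1) emeasure_interval(2)[OF assms(2)] by (metis null_sets_subset)
  then show False using emeasure_interval(1)[OF assms(2)] I_pos[OF assms(2)] by (auto simp: null_sets_def)
qed

lemma rearrangement_finite: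
  assumes "AE t in lebesgue_on I. rearrangement I x t < \<infinity>" "t \<in> I"
  shows "rearrangement I x t < \<infinity>"
  using AE_I_ex_below[OF assms] rearrangement_antimono[of _ t x]
  by (meson less_imp_le order_le_less_trans)

lemma rearr_le_iff:
  assumes "x \<in> L0 I" "0 \<le> d" "rearrangement I x t < \<infinity>"
  shows "rearr I x t \<le> d \<longleftrightarrow> emeasure (lebesgue_on I) {s\<in>I. d < \<bar>x s\<bar>} \<le> ennreal t"
  using rearrangement_le_iff[OF assms(1,2), of t] rearrangement_rearr[OF assms(3)] by simp

lemma rearr_leI:
  assumes "x \<in> L0 I" "0 \<le> d" "emeasure (lebesgue_on I) {s\<in>I. d < \<bar>x s\<bar>} \<le> ennreal t"
  shows "rearr I x t \<le> d" "rearrangement I x t < \<infinity>"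
proof -
  have *: "rearrangement I x t \<le> ereal d" using assms rearrangement_le_iff by blast
  then show "rearrangement I x t < \<infinity>" by (rule order_le_less_trans) simp
  with * show "rearr I x t \<le> d" using rearrangement_rearr by fastforce
qed

lemma emeasure_superlevel_rearr:
  assumes "x \<in> L0 I" "rearrangement I x t < \<infinity>"
  shows "emeasure (lebesgue_on I) {s\<in>I. rearr I x t < \<bar>x s\<bar>} \<le> ennreal t"
  using rearr_le_iff[OF assms(1) rearr_nonneg assms(2)] by blast

section \<open>Decreasing functions and their rearrangements\<close>

lemma antimono_on_L0:
  assumes "antimono_on I h" shows "h \<in> L0 I"
proof -
  have "mono_on I (\<lambda>t. - h t)"
    using assms by (auto simp: monotone_on_def)
  then have "(\<lambda>t. - h t) \<in> borel_measurable (restrict_space borel I)"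
    by (rule borel_measurable_mono_on_fnc)
  then have "(\<lambda>t. - (- h t)) \<in> borel_measurable (restrict_space borel I)"
    by (rule borel_measurable_uminus)
  then have h: "h \<in> borel_measurable (restrict_space borel I)" by simp
  show ?thesis
  proof (rule measurableI)
    fix A :: "real set" assume "A \<in> sets borel"
    from measurable_sets[OF h this] show "h -` A \<inter> space (lebesgue_on I) \<in> sets (lebesgue_on I)"
      by (auto simp: sets_restrict_space space_restrict_space)
  qed simp
qed

lemma antimono_on_rearr:
  assumes "\<And>t. t \<in> I \<Longrightarrow> rearrangement I x t < \<infinity>"
  shows "antimono_on I (rearr I x)"
proof (rule monotone_onI)
  fix s t assume "s \<in> I" "t \<in> I" "s \<le> t"
  then show "rearr I x s \<ge> rearr I x t"
    using rearrangement_antimono[of s t x] rearrangement_rearr assms by (metis ereal_less_eq(3))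
qed

text \<open>A monotone function has only countably many discontinuities, and equality holds at each
  point of continuity. The upper bound follows from \<open>{h t < \<bar>h\<bar>}\<close> lying in
  the interval (0, t); the lower bound uses continuity from the right.\<close>

lemma rearrangement_antimono_on:
  assumes h: "antimono_on I h" and pos: "\<And>t. t \<in> I \<Longrightarrow> 0 \<le> h t"
  shows "AE t in lebesgue_on I. rearrangement I h t = ereal (h t)"
proof -
  have "mono_on I (\<lambda>t. - h t)"
    using h by (auto simp: monotone_on_def)
  then have "countable {t\<in>I. \<not> continuous (at t within I) (\<lambda>t. - h t)}"
    by (rule mono_on_ctble_discont)
  then have null: "{t\<in>I. \<not> continuous (at t within I) (\<lambda>t. - h t)} \<in> null_sets lebesgue"
    by (simp add: countable_imp_null_set_lborel null_sets_completionI)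
  have eq: "rearrangement I h t = ereal (h t)"
    if t: "t \<in> I" and c: "continuous (at t within I) (\<lambda>t. - h t)" for t
  proof (rule antisym)
    have "emeasure (lebesgue_on I) {s\<in>I. h t < \<bar>h s\<bar>} \<le> emeasure (lebesgue_on I) {0<..<t}"
    proof (rule emeasure_mono)
      show "{s\<in>I. h t < \<bar>h s\<bar>} \<subseteq> {0<..<t}"
        using h t pos I_pos unfolding monotone_on_def by (auto, metis leI not_less)
    qed (rule emeasure_interval[OF t])
    then show "rearrangement I h t \<le> ereal (h t)"
      using rearrangement_le_iff[OF antimono_on_L0[OF h] pos[OF t]] emeasure_interval[OF t] by simp
    \<comment> \<open>A level below \<open>h u\<close> is exceeded on all of (0, u), a set of
      measure \<open>u > t\<close>, so it is not admissible at \<open>t\<close>.\<close>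
    have right: "ereal (h u) \<le> rearrangement I h t" if u: "u \<in> I" "t < u" for u
    proof (rule ccontr)
      assume "\<not> ?thesis"
      then have "rearrangement I h t < ereal (h u)" by simp
      then obtain c where c: "c < h u" "emeasure (lebesgue_on I) {s\<in>I. c < \<bar>h s\<bar>} \<le> ennreal t"
        unfolding rearrangement_def INF_less_iff by auto
      have "ennreal u = emeasure (lebesgue_on I) {0<..<u}" using emeasure_interval[OF u(1)] by simp
      also have "\<dots> \<le> emeasure (lebesgue_on I) {s\<in>I. c < \<bar>h s\<bar>}"
      proof (intro emeasure_mono superlevel_sets antimono_on_L0 h subsetI CollectI conjI)
        fix s assume s: "s \<in> {0<..<u}"
        then show "s \<in> I" using I_down[OF u(1)] by auto
        then have "h u \<le> h s" using h u s unfolding monotone_on_def by auto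
        then show "c < \<bar>h s\<bar>" using c by auto
      qed
      also have "\<dots> \<le> ennreal t" by (rule c)
      finally show False using u I_pos[OF t] by (simp add: ennreal_le_iff)
    qed
    show "ereal (h t) \<le> rearrangement I h t"
    proof (rule ccontr)
      assume "\<not> ?thesis"
      then have lt: "rearrangement I h t < ereal (h t)" by simp
      define r where "r = rearr I h t"
      have r: "rearrangement I h t = ereal r"
        unfolding r_def by (rule rearrangement_rearr) (use lt in auto)
      with lt have "r < h t" by simp
      have "isCont (\<lambda>t. - h t) t" using c unfolding at_within_open[OF t I_open] .
      then have "((\<lambda>t. - (- h t)) \<longlongrightarrow> - (- h t)) (at t)"
        unfolding isCont_def by (rule tendsto_minus)
      then have "(h \<longlongrightarrow> h t) (at_right t)" by (simp add: filterlim_at_split)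
      then have "\<forall>\<^sub>F u in at_right t. r < h u" using \<open>r < h t\<close> by (rule order_tendstoD)
      moreover obtain b where b: "b \<in> I" "t < b" using I_above[OF t] by auto
      ultimately have "\<exists>u. u \<in> I \<and> t < u \<and> r < h u"
      proof -
        obtain b' where "b' > t" "\<And>u. t < u \<Longrightarrow> u < b' \<Longrightarrow> r < h u"
          using \<open>\<forall>\<^sub>F u in at_right t. r < h u\<close> unfolding eventually_at_right_field by auto
        moreover obtain u where "t < u" "u < min b b'" using dense[of t "min b b'"] b calculation(1) by auto
        ultimately show ?thesis using I_down[OF b(1), of u] I_pos[OF t] by auto
      qed
      then show False using right r by force
    qed
  qed
  show ?thesis
    unfolding AE_I_iff
    by (rule AE_I'[OF null]) (use eq in auto)
qed

end

section \<open>Products and Calderon products\<close>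

text \<open>
  \<open>solid_space\<close> omits the triangle inequality, because for \<open>(E \<odot> F)\<^sup>(\<^sup>*\<^sup>)\<close> that is only known at the
  very end.
\<close>

definition solid_space :: "real set \<Rightarrow> fspace \<Rightarrow> bool" where
  "solid_space I X \<longleftrightarrow>
     elems X \<subseteq> L0 I \<and> elems X \<noteq> {} \<and>
     (\<forall>x\<in>elems X. 0 \<le> qnorm X x) \<and>
     (\<forall>x\<in>elems X. qnorm X x = 0 \<longrightarrow> (AE t in lebesgue_on I. x t = 0)) \<and>
     (\<forall>a. \<forall>x\<in>elems X. (\<lambda>t. a * x t) \<in> elems X \<and> qnorm X (\<lambda>t. a * x t) = \<bar>a\<bar> * qnorm X x) \<and>
     (\<forall>y\<in>elems X. \<forall>x\<in>L0 I. (AE t in lebesgue_on I. \<bar>x t\<bar> \<le> \<bar>y t\<bar>) \<longrightarrow>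
        x \<in> elems X \<and> qnorm X x \<le> qnorm X y)"

text \<open>The constant is a parameter, so that it can be followed through symmetrizations and
  products; closure under addition is included because solidity alone does not give it.\<close>

definition quasi_triangle :: "fspace \<Rightarrow> real \<Rightarrow> bool" where
  "quasi_triangle X K \<longleftrightarrow> 1 \<le> K \<and>
     (\<forall>x\<in>elems X. \<forall>y\<in>elems X. (\<lambda>t. x t + y t) \<in> elems X \<and>
        qnorm X (\<lambda>t. x t + y t) \<le> K * (qnorm X x + qnorm X y))"

lemma quasi_triangle_add:
  assumes "quasi_triangle X K" "x \<in> elems X" "y \<in> elems X"
  shows "(\<lambda>t. x t + y t) \<in> elems X"
  using assms unfolding quasi_triangle_def by blast

lemma solid_space_L0: "solid_space I X \<Longrightarrow> x \<in> elems X \<Longrightarrow> x \<in> L0 I"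
  unfolding solid_space_def by blast

lemma solid_space_nonneg: "solid_space I X \<Longrightarrow> x \<in> elems X \<Longrightarrow> 0 \<le> qnorm X x"
  unfolding solid_space_def by blast

lemma solid_space_zeroD:
  "solid_space I X \<Longrightarrow> x \<in> elems X \<Longrightarrow> qnorm X x = 0 \<Longrightarrow> AE t in lebesgue_on I. x t = 0"
  unfolding solid_space_def by blast

lemma solid_space_scale:
  assumes "solid_space I X" "x \<in> elems X"
  shows "(\<lambda>t. a * x t) \<in> elems X" "qnorm X (\<lambda>t. a * x t) = \<bar>a\<bar> * qnorm X x"
  using assms unfolding solid_space_def by blast+

lemma solid_space_ideal:
  assumes "solid_space I X" "y \<in> elems X" "x \<in> L0 I" "AE t in lebesgue_on I. \<bar>x t\<bar> \<le> \<bar>y t\<bar>"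
  shows "x \<in> elems X" "qnorm X x \<le> qnorm X y"
  using assms unfolding solid_space_def by blast+

lemma solid_space_cong:
  assumes "solid_space I X" "y \<in> elems X" "x \<in> L0 I" "AE t in lebesgue_on I. \<bar>x t\<bar> = \<bar>y t\<bar>"
  shows "x \<in> elems X" "qnorm X x = qnorm X y"
proof -
  have le: "AE t in lebesgue_on I. \<bar>x t\<bar> \<le> \<bar>y t\<bar>"
    and ge: "AE t in lebesgue_on I. \<bar>y t\<bar> \<le> \<bar>x t\<bar>"
    by (rule eventually_mono[OF assms(4)], simp)+
  show x: "x \<in> elems X"
    by (rule solid_space_ideal(1)[OF assms(1-3) le])
  have "qnorm X x \<le> qnorm X y"
    by (rule solid_space_ideal(2)[OF assms(1-3) le])
  moreover have "qnorm X y \<le> qnorm X x"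
    by (rule solid_space_ideal(2)[OF assms(1) x solid_space_L0[OF assms(1,2)] ge])
  ultimately show "qnorm X x = qnorm X y" by simp
qed

lemma solid_space_zero:
  assumes "solid_space I X"
  shows "(\<lambda>t. 0) \<in> elems X" "qnorm X (\<lambda>t. 0) = 0"
proof -
  obtain x where "x \<in> elems X" using assms unfolding solid_space_def by blast
  from solid_space_scale[OF assms this, of 0]
  show "(\<lambda>t. 0) \<in> elems X" "qnorm X (\<lambda>t. 0) = 0" by simp_all
qed

lemma quasi_normed_ideal_space_solid:
  assumes "quasi_normed_ideal_space I X"
  shows "solid_space I X"
proof -
  have n: "quasi_normed_space I X"
    and i: "\<forall>y\<in>elems X. \<forall>x\<in>L0 I. (AE t in lebesgue_on I. \<bar>x t\<bar> \<le> \<bar>y t\<bar>) \<longrightarrow>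
        x \<in> elems X \<and> qnorm X x \<le> qnorm X y"
    using assms unfolding quasi_normed_ideal_space_def by blast+
  show ?thesis
    unfolding solid_space_def
    by (insert n i, unfold quasi_normed_space_def, elim conjE, intro conjI ballI allI) blast+
qed

lemma quasi_normed_ideal_space_triangle:
  assumes "quasi_normed_ideal_space I X"
  obtains K where "quasi_triangle X K"
proof -
  have "quasi_normed_space I X" using assms unfolding quasi_normed_ideal_space_def by blast
  then have "\<exists>K. quasi_triangle X K" unfolding quasi_normed_space_def quasi_triangle_def by (elim conjE) metis
  with that show thesis by blast
qed

lemma solid_space_quasi_normed:
  assumes X: "solid_space I X" and K: "quasi_triangle X K"
  shows "quasi_normed_space I X"
  unfolding quasi_normed_space_def
proof (intro conjI ballI allI impI)
  show "elems X \<subseteq> L0 I" using solid_space_L0[OF X] by blast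
next
  fix x y assume x: "x \<in> elems X" and y: "y \<in> L0 I" and *: "AE t in lebesgue_on I. y t = x t"
  have "AE t in lebesgue_on I. \<bar>y t\<bar> = \<bar>x t\<bar>" using * by eventually_elim simp
  from solid_space_cong[OF X x y this] show "y \<in> elems X" "qnorm X y = qnorm X x" .
next
  fix x assume x: "x \<in> elems X"
  show "(qnorm X x = 0) = (AE t in lebesgue_on I. x t = 0)"
  proof
    assume "AE t in lebesgue_on I. x t = 0"
    then have "AE t in lebesgue_on I. \<bar>x t\<bar> = \<bar>0\<bar>" by auto
    from solid_space_cong(2)[OF X solid_space_zero(1)[OF X] solid_space_L0[OF X x] this]
    show "qnorm X x = 0" using solid_space_zero(2)[OF X] by simp
  qed (rule solid_space_zeroD[OF X x])
next
  show "\<exists>K\<ge>1. \<forall>x\<in>elems X. \<forall>y\<in>elems X. qnorm X (\<lambda>t. x t + y t) \<le> K * (qnorm X x + qnorm X y)"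
    using K unfolding quasi_triangle_def by blast
next
  fix x y assume "x \<in> elems X" "y \<in> elems X"
  then show "(\<lambda>t. x t + y t) \<in> elems X" using K unfolding quasi_triangle_def by blast
qed (fact solid_space_zero[OF X] | rule solid_space_scale[OF X] solid_space_nonneg[OF X]; assumption)+

section \<open>The product quasi-norm, apart from definiteness\<close>

text \<open>The product asks for exact factorizations, but domination suffices:
  \<open>z = u / y\<close> is dominated by \<open>x\<close>, hence lies in X, and
  \<open>u = z * y\<close>. Where \<open>y\<close> vanishes so does \<open>u\<close>, and division
  by zero makes \<open>z\<close> vanish there too, so both facts survive.\<close>

lemma product_space_le:
  assumes X: "solid_space I X" and Y: "solid_space I Y"
    and x: "x \<in> elems X" and y: "y \<in> elems Y" and u: "u \<in> L0 I"
    and le: "AE t in lebesgue_on I. \<bar>u t\<bar> \<le> \<bar>x t\<bar> * \<bar>y t\<bar>"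
  shows "u \<in> elems (product_space I X Y)" "qnorm (product_space I X Y) u \<le> qnorm X x * qnorm Y y"
proof -
  define z where "z t = u t / y t" for t
  have [measurable]: "u \<in> L0 I" "y \<in> L0 I" using u solid_space_L0[OF Y y] .
  have z: "z \<in> L0 I" unfolding z_def by measurable
  have zx: "AE t in lebesgue_on I. \<bar>z t\<bar> \<le> \<bar>x t\<bar>"
    using le by eventually_elim (auto simp: z_def abs_divide divide_le_eq)
  have eq: "AE t in lebesgue_on I. u t = z t * y t"
    using le by eventually_elim (auto simp: z_def)
  note zX = solid_space_ideal[OF X x z zx]
  show "u \<in> elems (product_space I X Y)"
    using u zX(1) y eq unfolding product_space_def by auto
  have "qnorm (product_space I X Y) u \<le> qnorm X z * qnorm Y y"
    unfolding product_space_def select_convs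
  proof (rule cInf_lower)
    show "bdd_below {qnorm X x * qnorm Y y |x y. x \<in> elems X \<and> y \<in> elems Y \<and> (AE t in lebesgue_on I. u t = x t * y t)}"
      using solid_space_nonneg[OF X] solid_space_nonneg[OF Y] by (intro bdd_belowI[of _ 0]) auto
  qed (use zX(1) y eq in blast)
  also have "\<dots> \<le> qnorm X x * qnorm Y y"
    using zX(2) solid_space_nonneg[OF Y y] by (rule mult_right_mono)
  finally show "qnorm (product_space I X Y) u \<le> qnorm X x * qnorm Y y" .
qed

lemma product_space_nonneg:
  assumes X: "solid_space I X" and Y: "solid_space I Y" and u: "u \<in> elems (product_space I X Y)"
  shows "0 \<le> qnorm (product_space I X Y) u"
  unfolding product_space_def select_convs
proof (rule cInf_greatest)
  show "{qnorm X x * qnorm Y y |x y. x \<in> elems X \<and> y \<in> elems Y \<and> (AE t in lebesgue_on I. u t = x t * y t)} \<noteq> {}"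
    using u unfolding product_space_def by auto
qed (use solid_space_nonneg[OF X] solid_space_nonneg[OF Y] in auto)

text \<open>Rescaling balances the two factors.\<close>

lemma product_space_factor:
  assumes X: "solid_space I X" and Y: "solid_space I Y"
    and u: "u \<in> elems (product_space I X Y)" and a: "qnorm (product_space I X Y) u < a"
  obtains x y where "x \<in> elems X" "y \<in> elems Y" "AE t in lebesgue_on I. u t = x t * y t"
    "qnorm X x \<le> sqrt a" "qnorm Y y \<le> sqrt a"
proof -
  let ?S = "{qnorm X x * qnorm Y y |x y. x \<in> elems X \<and> y \<in> elems Y \<and> (AE t in lebesgue_on I. u t = x t * y t)}"
  have "?S \<noteq> {}" using u unfolding product_space_def by auto
  moreover have "Inf ?S < a" using a unfolding product_space_def by simp
  ultimately obtain x y where xy: "x \<in> elems X" "y \<in> elems Y" "AE t in lebesgue_on I. u t = x t * y t"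
    and lt: "qnorm X x * qnorm Y y < a"
    using cInf_lessD[of ?S a] by auto
  have a0: "0 < a" using product_space_nonneg[OF X Y u] a by simp
  define p q where "p = qnorm X x" and "q = qnorm Y y"
  have pq: "0 \<le> p" "0 \<le> q" "p * q < a"
    using solid_space_nonneg[OF X xy(1)] solid_space_nonneg[OF Y xy(2)] lt unfolding p_def q_def by auto
  show thesis
  proof (cases "p = 0 \<or> q = 0")
    \<comment> \<open>Scaling cannot balance a factor of quasi-norm 0. Definiteness makes that
      factor, and with it \<open>u\<close>, vanish almost everywhere, and two zero functions serve
      as factors.\<close>
    case True
    then have "AE t in lebesgue_on I. x t * y t = 0"
    proof
      assume "p = 0"
      then have "AE t in lebesgue_on I. x t = 0" using solid_space_zeroD[OF X xy(1)] unfolding p_def by blast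
      then show ?thesis by eventually_elim simp
    next
      assume "q = 0"
      then have "AE t in lebesgue_on I. y t = 0" using solid_space_zeroD[OF Y xy(2)] unfolding q_def by blast
      then show ?thesis by eventually_elim simp
    qed
    with xy(3) have "AE t in lebesgue_on I. u t = 0 * 0" by eventually_elim simp
    then show thesis
      using that[OF solid_space_zero(1)[OF X] solid_space_zero(1)[OF Y]] a0
        solid_space_zero(2)[OF X] solid_space_zero(2)[OF Y] by simp
  next
    case False
    \<comment> \<open>This gives the first factor quasi-norm exactly \<open>sqrt a\<close>; the
      second gets \<open>p * q / sqrt a\<close>, which stays below \<open>sqrt a\<close>.\<close>
    define c where "c = sqrt a / p"
    have pos: "0 < p" "0 < q" "0 < c" using False pq a0 by (auto simp: c_def)
    have "\<bar>1 / c\<bar> * q = p * q / sqrt a" using pos a0 by (simp add: c_def)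
    also have "\<dots> \<le> a / sqrt a" using pq a0 by (intro divide_right_mono) auto
    also have "\<dots> = sqrt a" using a0 by (simp add: real_div_sqrt)
    finally have q': "\<bar>1 / c\<bar> * q \<le> sqrt a" .
    show thesis
    proof (rule that)
      show "(\<lambda>t. c * x t) \<in> elems X" "(\<lambda>t. (1 / c) * y t) \<in> elems Y"
        using solid_space_scale[OF X xy(1)] solid_space_scale[OF Y xy(2)] by blast+
      show "AE t in lebesgue_on I. u t = c * x t * ((1 / c) * y t)"
        using xy(3) by eventually_elim (use pos in simp)
      show "qnorm X (\<lambda>t. c * x t) \<le> sqrt a"
        unfolding solid_space_scale(2)[OF X xy(1)] using pos a0 by (simp add: c_def flip: p_def)
      show "qnorm Y (\<lambda>t. (1 / c) * y t) \<le> sqrt a"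
        unfolding solid_space_scale(2)[OF Y xy(2)] using q' by (simp flip: q_def)
    qed
  qed
qed

lemma product_space_L0: "u \<in> elems (product_space I X Y) \<Longrightarrow> u \<in> L0 I"
  unfolding product_space_def by simp

lemma product_space_ideal:
  assumes X: "solid_space I X" and Y: "solid_space I Y"
    and v: "v \<in> elems (product_space I X Y)" and u: "u \<in> L0 I"
    and le: "AE t in lebesgue_on I. \<bar>u t\<bar> \<le> \<bar>v t\<bar>"
  shows "u \<in> elems (product_space I X Y)" "qnorm (product_space I X Y) u \<le> qnorm (product_space I X Y) v"
proof -
  have *: "u \<in> elems (product_space I X Y) \<and> qnorm (product_space I X Y) u \<le> a"
    if a: "qnorm (product_space I X Y) v < a" for a
  proof -
    obtain x y where xy: "x \<in> elems X" "y \<in> elems Y" "AE t in lebesgue_on I. v t = x t * y t"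
      "qnorm X x \<le> sqrt a" "qnorm Y y \<le> sqrt a"
      using product_space_factor[OF X Y v a] .
    have 1: "AE t in lebesgue_on I. \<bar>u t\<bar> \<le> \<bar>x t\<bar> * \<bar>y t\<bar>"
      using le xy(3) by eventually_elim (simp add: abs_mult)
    have "qnorm X x * qnorm Y y \<le> sqrt a * sqrt a"
      using xy solid_space_nonneg[OF X xy(1)] solid_space_nonneg[OF Y xy(2)]
        product_space_nonneg[OF X Y v] a by (intro mult_mono) auto
    also have "\<dots> = a" using product_space_nonneg[OF X Y v] a by simp
    finally show ?thesis using product_space_le[OF X Y xy(1,2) u 1] by simp
  qed
  show "u \<in> elems (product_space I X Y)" using *[OF less_add_one] by simp
  show "qnorm (product_space I X Y) u \<le> qnorm (product_space I X Y) v"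
    by (rule dense_ge) (use * in blast)
qed

text \<open>Derived from the ideal property alone, since it is applied to the product of the
  symmetrizations, which is not shown to be a \<open>solid_space\<close>.\<close>

lemma product_space_abs:
  assumes X: "solid_space I X" and Y: "solid_space I Y"
    and u: "u \<in> L0 I"
  shows "(\<lambda>t. \<bar>u t\<bar>) \<in> elems (product_space I X Y) \<longleftrightarrow> u \<in> elems (product_space I X Y)"
    "u \<in> elems (product_space I X Y) \<Longrightarrow>
      qnorm (product_space I X Y) (\<lambda>t. \<bar>u t\<bar>) = qnorm (product_space I X Y) u"
proof -
  have [measurable]: "u \<in> L0 I" by fact
  have m: "(\<lambda>t. \<bar>u t\<bar>) \<in> L0 I" by measurable
  show *: "(\<lambda>t. \<bar>u t\<bar>) \<in> elems (product_space I X Y) \<longleftrightarrow> u \<in> elems (product_space I X Y)"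
    using product_space_ideal(1)[OF X Y _ u, of "\<lambda>t. \<bar>u t\<bar>"] product_space_ideal(1)[OF X Y _ m, of u] by auto
  assume "u \<in> elems (product_space I X Y)"
  with * show "qnorm (product_space I X Y) (\<lambda>t. \<bar>u t\<bar>) = qnorm (product_space I X Y) u"
    using product_space_ideal(2)[OF X Y _ u, of "\<lambda>t. \<bar>u t\<bar>"] product_space_ideal(2)[OF X Y _ m, of u]
    by (intro antisym) auto
qed

text \<open>Scaling one factor gives the upper estimate; the same estimate for \<open>1 / c\<close>
  and the scaled function gives the reverse one.\<close>

lemma product_space_scale:
  assumes X: "solid_space I X" and Y: "solid_space I Y"
    and u: "u \<in> elems (product_space I X Y)"
  shows "(\<lambda>t. c * u t) \<in> elems (product_space I X Y)"
    "qnorm (product_space I X Y) (\<lambda>t. c * u t) = \<bar>c\<bar> * qnorm (product_space I X Y) u"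
proof -
  let ?P = "product_space I X Y"
  have le: "(\<lambda>t. c * v t) \<in> elems ?P \<and> qnorm ?P (\<lambda>t. c * v t) \<le> \<bar>c\<bar> * a"
    if v: "v \<in> elems ?P" and a: "qnorm ?P v < a" for a c v
  proof -
    obtain x y where xy: "x \<in> elems X" "y \<in> elems Y" "AE t in lebesgue_on I. v t = x t * y t"
      "qnorm X x \<le> sqrt a" "qnorm Y y \<le> sqrt a"
      using product_space_factor[OF X Y v a] .
    have 1: "AE t in lebesgue_on I. \<bar>c * v t\<bar> \<le> \<bar>c * x t\<bar> * \<bar>y t\<bar>"
      using xy(3) by eventually_elim (simp add: abs_mult)
    have [measurable]: "v \<in> L0 I" using product_space_L0[OF v] .
    have m: "(\<lambda>t. c * v t) \<in> L0 I" by measurable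
    have "qnorm X x * qnorm Y y \<le> sqrt a * sqrt a"
      using xy solid_space_nonneg[OF X xy(1)] solid_space_nonneg[OF Y xy(2)]
        product_space_nonneg[OF X Y v] a by (intro mult_mono) auto
    also have "\<dots> = a" using product_space_nonneg[OF X Y v] a by simp
    finally have "\<bar>c\<bar> * qnorm X x * qnorm Y y \<le> \<bar>c\<bar> * a"
      by (simp add: mult_left_mono mult.assoc)
    then show ?thesis
      using product_space_le[OF X Y solid_space_scale(1)[OF X xy(1)] xy(2) m 1] solid_space_scale(2)[OF X xy(1)]
      by simp
  qed
  have le': "qnorm ?P (\<lambda>t. c * v t) \<le> \<bar>c\<bar> * qnorm ?P v" if v: "v \<in> elems ?P" for c v
  proof (cases "c = 0")
    case True
    then show ?thesis using le[OF v less_add_one, of c] by simp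
  next
    case False
    show ?thesis
    proof (rule dense_ge)
      fix b assume "\<bar>c\<bar> * qnorm ?P v < b"
      then have "qnorm ?P v < b / \<bar>c\<bar>" using False by (simp add: less_divide_eq mult.commute)
      from le[OF v this, of c] False show "qnorm ?P (\<lambda>t. c * v t) \<le> b" by simp
    qed
  qed
  show cu: "(\<lambda>t. c * u t) \<in> elems ?P" using le[OF u less_add_one] by blast
  show "qnorm ?P (\<lambda>t. c * u t) = \<bar>c\<bar> * qnorm ?P u"
  proof (cases "c = 0")
    case True
    then show ?thesis using le'[OF u, of c] product_space_nonneg[OF X Y cu] by simp
  next
    case False
    have "qnorm ?P u = qnorm ?P (\<lambda>t. (1 / c) * (c * u t))" using False by simp
    also have "\<dots> \<le> \<bar>1 / c\<bar> * qnorm ?P (\<lambda>t. c * u t)" by (rule le'[OF cu])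
    finally have "\<bar>c\<bar> * qnorm ?P u \<le> qnorm ?P (\<lambda>t. c * u t)" using False by (simp add: le_divide_eq mult.commute)
    with le'[OF u, of c] show ?thesis by simp
  qed
qed

text \<open>With balanced factors, \<open>x * y + x' * y'\<close> is dominated by the product of
  \<open>\<bar>x\<bar> + \<bar>x'\<bar>\<close> and \<open>\<bar>y\<bar> + \<bar>y'\<bar>\<close>.
  Each sum costs its own triangle constant, and the 2 comes from
  \<open>(sqrt a + sqrt b)\<^sup>2 \<le> 2 * (a + b)\<close>.\<close>

lemma product_space_triangle:
  assumes X: "solid_space I X" and Y: "solid_space I Y"
    and K: "quasi_triangle X K" and L: "quasi_triangle Y L"
  shows "quasi_triangle (product_space I X Y) (2 * K * L)"
  unfolding quasi_triangle_def
proof (intro conjI ballI)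
  let ?P = "product_space I X Y"
  have KL: "1 \<le> K" "1 \<le> L" using K L unfolding quasi_triangle_def by auto
  then have KL1: "1 \<le> K * L" using mult_mono[of 1 K 1 L] by simp
  then show "1 \<le> 2 * K * L" by simp
  fix u v assume u: "u \<in> elems ?P" and v: "v \<in> elems ?P"
  have *: "(\<lambda>t. u t + v t) \<in> elems ?P \<and> qnorm ?P (\<lambda>t. u t + v t) \<le> 2 * K * L * (a + b)"
    if a: "qnorm ?P u < a" and b: "qnorm ?P v < b" for a b
  proof -
    have pos: "0 < a" "0 < b" using a b product_space_nonneg[OF X Y] u v by fastforce+
    obtain x y where xy: "x \<in> elems X" "y \<in> elems Y" "AE t in lebesgue_on I. u t = x t * y t"
      "qnorm X x \<le> sqrt a" "qnorm Y y \<le> sqrt a"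
      using product_space_factor[OF X Y u a] .
    obtain x' y' where xy': "x' \<in> elems X" "y' \<in> elems Y" "AE t in lebesgue_on I. v t = x' t * y' t"
      "qnorm X x' \<le> sqrt b" "qnorm Y y' \<le> sqrt b"
      using product_space_factor[OF X Y v b] .
    have abs: "(\<lambda>t. \<bar>z t\<bar>) \<in> elems Z \<and> qnorm Z (\<lambda>t. \<bar>z t\<bar>) = qnorm Z z" if "solid_space I Z" "z \<in> elems Z" for z Z
    proof -
      have [measurable]: "z \<in> L0 I" using solid_space_L0 that by blast
      show ?thesis using solid_space_cong[OF that, of "\<lambda>t. \<bar>z t\<bar>"] by simp
    qed
    let ?x = "\<lambda>t. \<bar>x t\<bar> + \<bar>x' t\<bar>" and ?y = "\<lambda>t. \<bar>y t\<bar> + \<bar>y' t\<bar>"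
    have x: "?x \<in> elems X" "qnorm X ?x \<le> K * (sqrt a + sqrt b)"
    proof -
      have "qnorm X ?x \<le> K * (qnorm X x + qnorm X x')" "?x \<in> elems X"
        using K abs[OF X xy(1)] abs[OF X xy'(1)] unfolding quasi_triangle_def by metis+
      moreover have "K * (qnorm X x + qnorm X x') \<le> K * (sqrt a + sqrt b)"
        using KL xy xy' by (intro mult_left_mono add_mono) auto
      ultimately show "?x \<in> elems X" "qnorm X ?x \<le> K * (sqrt a + sqrt b)" by auto
    qed
    have y: "?y \<in> elems Y" "qnorm Y ?y \<le> L * (sqrt a + sqrt b)"
    proof -
      have "qnorm Y ?y \<le> L * (qnorm Y y + qnorm Y y')" "?y \<in> elems Y"
        using L abs[OF Y xy(2)] abs[OF Y xy'(2)] unfolding quasi_triangle_def by metis+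
      moreover have "L * (qnorm Y y + qnorm Y y') \<le> L * (sqrt a + sqrt b)"
        using KL xy xy' by (intro mult_left_mono add_mono) auto
      ultimately show "?y \<in> elems Y" "qnorm Y ?y \<le> L * (sqrt a + sqrt b)" by auto
    qed
    have [measurable]: "u \<in> L0 I" "v \<in> L0 I" using u v product_space_L0 by auto
    have m: "(\<lambda>t. u t + v t) \<in> L0 I" by measurable
    have 1: "AE t in lebesgue_on I. \<bar>u t + v t\<bar> \<le> \<bar>\<bar>x t\<bar> + \<bar>x' t\<bar>\<bar> * \<bar>\<bar>y t\<bar> + \<bar>y' t\<bar>\<bar>"
      using xy(3) xy'(3)
    proof eventually_elim
      case (elim t)
      have "\<bar>x t * y t + x' t * y' t\<bar> \<le> \<bar>x t\<bar> * \<bar>y t\<bar> + \<bar>x' t\<bar> * \<bar>y' t\<bar>"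
        using abs_triangle_ineq[of "x t * y t" "x' t * y' t"] by (simp add: abs_mult)
      also have "\<dots> \<le> (\<bar>x t\<bar> + \<bar>x' t\<bar>) * (\<bar>y t\<bar> + \<bar>y' t\<bar>)" by (simp add: algebra_simps)
      finally show ?case using elim by simp
    qed
    have "qnorm X ?x * qnorm Y ?y \<le> (K * (sqrt a + sqrt b)) * (L * (sqrt a + sqrt b))"
      using x y solid_space_nonneg[OF X x(1)] solid_space_nonneg[OF Y y(1)] by (intro mult_mono) auto
    also have "\<dots> = K * L * (sqrt a + sqrt b)\<^sup>2" by (simp add: power2_eq_square)
    also have "\<dots> \<le> K * L * (2 * (a + b))"
    proof (rule mult_left_mono)
      have "(sqrt a + sqrt b)\<^sup>2 + (sqrt a - sqrt b)\<^sup>2 = 2 * (a + b)"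
        using pos by (simp add: power2_sum power2_diff)
      then show "(sqrt a + sqrt b)\<^sup>2 \<le> 2 * (a + b)"
        using zero_le_power2[of "sqrt a - sqrt b"] by linarith
    qed (use KL1 in simp)
    finally show ?thesis using product_space_le[OF X Y x(1) y(1) m 1] by (simp add: algebra_simps)
  qed
  show "(\<lambda>t. u t + v t) \<in> elems ?P" using *[OF less_add_one less_add_one] by blast
  show "qnorm ?P (\<lambda>t. u t + v t) \<le> 2 * K * L * (qnorm ?P u + qnorm ?P v)"
  proof (rule field_le_epsilon)
    fix e :: real assume e: "0 < e"
    \<comment> \<open>Both quasi-norms are enlarged by \<open>d\<close>, so the total error is
      \<open>2 * K * L * (2 * d) = e\<close>.\<close>
    define d where "d = e / (4 * K * L)"
    have d: "0 < d" "2 * K * L * (2 * d) = e" using e KL by (auto simp: d_def)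
    have "qnorm ?P (\<lambda>t. u t + v t) \<le> 2 * K * L * ((qnorm ?P u + d) + (qnorm ?P v + d))"
      using *[of "qnorm ?P u + d" "qnorm ?P v + d"] d by simp
    also have "\<dots> = 2 * K * L * (qnorm ?P u + qnorm ?P v) + 2 * K * L * (2 * d)"
      by (simp only: distrib_left[symmetric]) (simp add: algebra_simps)
    finally show "qnorm ?P (\<lambda>t. u t + v t) \<le> 2 * K * L * (qnorm ?P u + qnorm ?P v) + e"
      using d by simp
  qed
qed

section \<open>Transfer between products and Calderon products by squaring\<close>

text \<open>Isolating the relation lets one pair of transfer lemmas serve both inclusions: it links
  the Calderon product to the product and is inherited by their symmetrizations.\<close>

definition square_root_of :: "real set \<Rightarrow> fspace \<Rightarrow> fspace \<Rightarrow> bool" where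
  "square_root_of I K P \<longleftrightarrow> elems K \<subseteq> L0 I \<and>
     (\<forall>x\<in>L0 I. (x \<in> elems K \<longleftrightarrow> (\<lambda>t. (x t)\<^sup>2) \<in> elems P) \<and>
        (x \<in> elems K \<longrightarrow> qnorm K x = sqrt (qnorm P (\<lambda>t. (x t)\<^sup>2))))"

text \<open>Squaring the inequality at a level \<open>c\<close> bounds the quasi-norm of the square
  by \<open>c\<^sup>2\<close>. Conversely, a balanced factorization of the square has both factors
  of quasi-norm at most \<open>c\<close>; dividing each by \<open>c\<close> and taking roots shows
  that \<open>c\<close> is a level.\<close>

lemma calderon_half_square_root:
  assumes X: "solid_space I X" and Y: "solid_space I Y"
  shows "square_root_of I (calderon_half I X Y) (product_space I X Y)"
  unfolding square_root_of_def
proof (intro conjI ballI impI)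
  let ?K = "calderon_half I X Y" and ?P = "product_space I X Y"
  show "elems ?K \<subseteq> L0 I" unfolding calderon_half_def by auto
  fix x assume x[measurable]: "x \<in> L0 I"
  have m: "(\<lambda>t. (x t)\<^sup>2) \<in> L0 I" by measurable
  have 1: "(\<lambda>t. (x t)\<^sup>2) \<in> elems ?P \<and> qnorm ?P (\<lambda>t. (x t)\<^sup>2) \<le> c\<^sup>2"
    if c: "c \<in> calderon_levels I X Y x" for c
  proof -
    obtain x0 x1 where c: "0 < c" "x0 \<in> elems X" "x1 \<in> elems Y" "qnorm X x0 \<le> 1" "qnorm Y x1 \<le> 1"
      and le: "AE t in lebesgue_on I. \<bar>x t\<bar> \<le> c * (sqrt \<bar>x0 t\<bar> * sqrt \<bar>x1 t\<bar>)"
      using c unfolding calderon_levels_def by blast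
    have le': "AE t in lebesgue_on I. \<bar>(x t)\<^sup>2\<bar> \<le> \<bar>c\<^sup>2 * x0 t\<bar> * \<bar>x1 t\<bar>"
      using le
    proof eventually_elim
      case (elim t)
      then have "\<bar>x t\<bar>\<^sup>2 \<le> (c * (sqrt \<bar>x0 t\<bar> * sqrt \<bar>x1 t\<bar>))\<^sup>2" by (intro power_mono) auto
      then show ?case by (simp add: power_mult_distrib abs_mult)
    qed
    have "c\<^sup>2 * (qnorm X x0 * qnorm Y x1) \<le> c\<^sup>2 * (1 * 1)"
      using c solid_space_nonneg[OF X c(2)] solid_space_nonneg[OF Y c(3)]
      by (intro mult_left_mono mult_mono) auto
    then show ?thesis
      using product_space_le[OF X Y solid_space_scale(1)[OF X c(2)] c(3) m le'] solid_space_scale(2)[OF X c(2)]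
      by (simp add: mult.assoc)
  qed
  have 2: "c \<in> calderon_levels I X Y x"
    if P: "(\<lambda>t. (x t)\<^sup>2) \<in> elems ?P" and c: "0 < c" "qnorm ?P (\<lambda>t. (x t)\<^sup>2) < c\<^sup>2" for c
  proof -
    obtain x0 x1 where z: "x0 \<in> elems X" "x1 \<in> elems Y" "AE t in lebesgue_on I. (x t)\<^sup>2 = x0 t * x1 t"
      "qnorm X x0 \<le> sqrt (c\<^sup>2)" "qnorm Y x1 \<le> sqrt (c\<^sup>2)"
      using product_space_factor[OF X Y P c(2)] .
    have "AE t in lebesgue_on I. \<bar>x t\<bar> \<le> c * (sqrt \<bar>1 / c * x0 t\<bar> * sqrt \<bar>1 / c * x1 t\<bar>)"
      using z(3)
    proof eventually_elim
      case (elim t)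
      have "\<bar>x t\<bar> = sqrt \<bar>x0 t * x1 t\<bar>" using elim by (metis abs_power2 real_sqrt_abs)
      also have "\<dots> = c * (sqrt \<bar>1 / c * x0 t\<bar> * sqrt \<bar>1 / c * x1 t\<bar>)"
        using c by (simp add: abs_mult real_sqrt_mult real_sqrt_divide field_simps)
      finally show ?case by simp
    qed
    moreover have "qnorm X (\<lambda>t. 1 / c * x0 t) \<le> 1" "qnorm Y (\<lambda>t. 1 / c * x1 t) \<le> 1"
      using solid_space_scale(2)[OF X z(1), of "1 / c"] solid_space_scale(2)[OF Y z(2), of "1 / c"] z(4,5) c
      by (simp_all add: divide_le_eq)
    ultimately show ?thesis
      unfolding calderon_levels_def
      using c solid_space_scale(1)[OF X z(1), of "1 / c"] solid_space_scale(1)[OF Y z(2), of "1 / c"] by blast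
  qed
  show iff: "x \<in> elems ?K \<longleftrightarrow> (\<lambda>t. (x t)\<^sup>2) \<in> elems ?P"
  proof
    assume "x \<in> elems ?K"
    then show "(\<lambda>t. (x t)\<^sup>2) \<in> elems ?P" using 1 unfolding calderon_half_def by auto
  next
    assume P: "(\<lambda>t. (x t)\<^sup>2) \<in> elems ?P"
    define q where "q = qnorm ?P (\<lambda>t. (x t)\<^sup>2)"
    have "0 \<le> q" using product_space_nonneg[OF X Y P] unfolding q_def .
    \<comment> \<open>Factorizations are available only strictly above \<open>q\<close>, and levels
      must be positive; adding 1 meets both demands.\<close>
    then have "sqrt (q + 1) \<in> calderon_levels I X Y x" using 2[OF P, of "sqrt (q + 1)"] by (simp add: q_def)
    then show "x \<in> elems ?K" using x unfolding calderon_half_def by auto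
  qed
  assume xK: "x \<in> elems ?K"
  then have P: "(\<lambda>t. (x t)\<^sup>2) \<in> elems ?P" using iff by simp
  define q where "q = qnorm ?P (\<lambda>t. (x t)\<^sup>2)"
  have q0: "0 \<le> q" using product_space_nonneg[OF X Y P] unfolding q_def .
  have ne: "calderon_levels I X Y x \<noteq> {}" using xK unfolding calderon_half_def by simp
  show "qnorm ?K x = sqrt q"
    unfolding calderon_half_def select_convs
  proof (rule antisym)
    show "sqrt q \<le> Inf (calderon_levels I X Y x)"
    proof (rule cInf_greatest[OF ne])
      fix c assume c: "c \<in> calderon_levels I X Y x"
      then have "0 < c" unfolding calderon_levels_def by simp
      then show "sqrt q \<le> c" using 1[OF c] by (simp add: q_def real_le_lsqrt)
    qed
    show "Inf (calderon_levels I X Y x) \<le> sqrt q"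
    proof (rule dense_ge)
      fix c assume c: "sqrt q < c"
      then have "0 < c" using q0 by (meson order_le_less_trans real_sqrt_ge_zero)
      moreover have "q < c\<^sup>2" using c q0 by (smt (verit) real_less_lsqrt real_le_rsqrt not_le \<open>0 < c\<close>)
      ultimately have "c \<in> calderon_levels I X Y x" using 2[OF P] by (simp add: q_def)
      then show "Inf (calderon_levels I X Y x) \<le> c"
        by (rule cInf_lower) (auto intro!: bdd_belowI[of _ 0] simp: calderon_levels_def)
    qed
  qed
qed

lemma square_root_ofD:
  assumes "square_root_of I K P" "x \<in> elems K"
  shows "x \<in> L0 I" "(\<lambda>t. (x t)\<^sup>2) \<in> elems P" "qnorm K x = sqrt (qnorm P (\<lambda>t. (x t)\<^sup>2))"
proof -
  show x: "x \<in> L0 I" using assms unfolding square_root_of_def by blast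
  show "(\<lambda>t. (x t)\<^sup>2) \<in> elems P" "qnorm K x = sqrt (qnorm P (\<lambda>t. (x t)\<^sup>2))"
    using assms x unfolding square_root_of_def by blast+
qed

lemma square_root_ofI:
  assumes "square_root_of I K P" "x \<in> L0 I" "(\<lambda>t. (x t)\<^sup>2) \<in> elems P"
  shows "x \<in> elems K"
  using assms unfolding square_root_of_def by blast

lemma square_root_embeds:
  assumes K: "square_root_of I K P" and L: "square_root_of I L Q"
    and PQ: "embeds_with P Q (C\<^sup>2)" and C: "0 \<le> C"
  shows "embeds_with K L C"
  unfolding embeds_with_def
proof (intro conjI subsetI ballI)
  fix x assume x: "x \<in> elems K"
  note P = square_root_ofD[OF K x]
  have PQ': "elems P \<subseteq> elems Q" "\<And>x. x \<in> elems P \<Longrightarrow> qnorm Q x \<le> C\<^sup>2 * qnorm P x"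
    using PQ unfolding embeds_with_def by blast+
  show xL: "x \<in> elems L" using square_root_ofI[OF L P(1)] P(2) PQ'(1) by blast
  have "qnorm L x = sqrt (qnorm Q (\<lambda>t. (x t)\<^sup>2))" by (rule square_root_ofD(3)[OF L xL])
  also have "\<dots> \<le> sqrt (C\<^sup>2 * qnorm P (\<lambda>t. (x t)\<^sup>2))"
    by (rule real_sqrt_le_mono[OF PQ'(2)[OF P(2)]])
  also have "\<dots> = C * sqrt (qnorm P (\<lambda>t. (x t)\<^sup>2))" using C by (simp add: real_sqrt_mult)
  finally show "qnorm L x \<le> C * qnorm K x" unfolding P(3) .
qed

text \<open>The embedding is applied to \<open>sqrt \<bar>u\<bar>\<close> and then squared. Squaring
  is monotone here because the smaller side is nonnegative, whatever the sign of \<open>C\<close>;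
  the theorem speaks of every admissible constant, so no sign is prescribed.\<close>

lemma embeds_square:
  assumes K: "square_root_of I K P" and L: "square_root_of I L Q"
    and KL: "embeds_with K L C"
    and u: "u \<in> L0 I"
    and P: "(\<lambda>t. \<bar>u t\<bar>) \<in> elems P" "0 \<le> qnorm P (\<lambda>t. \<bar>u t\<bar>)"
    and Q: "(\<lambda>t. \<bar>u t\<bar>) \<in> elems Q \<Longrightarrow> 0 \<le> qnorm Q (\<lambda>t. \<bar>u t\<bar>)"
  shows "qnorm Q (\<lambda>t. \<bar>u t\<bar>) \<le> C\<^sup>2 * qnorm P (\<lambda>t. \<bar>u t\<bar>)"
proof -
  define x where "x t = sqrt \<bar>u t\<bar>" for t
  have [measurable]: "u \<in> L0 I" by fact
  have m: "x \<in> L0 I" unfolding x_def by measurable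
  have sq: "(\<lambda>t. (x t)\<^sup>2) = (\<lambda>t. \<bar>u t\<bar>)" by (simp add: x_def)
  have xK: "x \<in> elems K" by (rule square_root_ofI[OF K m]) (unfold sq, rule P)
  note qK = square_root_ofD(3)[OF K xK, unfolded sq]
  have xL: "x \<in> elems L" using KL xK unfolding embeds_with_def by blast
  note qL = square_root_ofD(2,3)[OF L xL, unfolded sq]
  have "qnorm L x \<le> C * qnorm K x"
    using KL xK unfolding embeds_with_def by blast
  then have "(sqrt (qnorm Q (\<lambda>t. \<bar>u t\<bar>)))\<^sup>2 \<le> (C * sqrt (qnorm P (\<lambda>t. \<bar>u t\<bar>)))\<^sup>2"
    unfolding qK qL(2) using Q[OF qL(1)] by (intro power_mono) auto
  then show ?thesis using P(2) Q[OF qL(1)] by (simp add: power_mult_distrib)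
qed

text \<open>Serves to show that best constants are themselves bounds, and later to take infima in
  the two factors of a product one after the other. For \<open>q = 0\<close> there is no division,
  but any element of \<open>S\<close> already gives \<open>p \<le> 0\<close>.\<close>

lemma le_cInf_mult:
  fixes p q :: real
  assumes "S \<noteq> {}" "\<And>a. a \<in> S \<Longrightarrow> p \<le> a * q" "0 \<le> q"
  shows "p \<le> Inf S * q"
proof (cases "q = 0")
  case True
  then show ?thesis using assms(1,2) by auto
next
  case False
  then have "p / q \<le> Inf S" using assms by (intro cInf_greatest) (auto simp: divide_le_eq)
  then show ?thesis using False assms(3) by (simp add: divide_le_eq)
qed

section \<open>Definiteness of the product from completeness\<close>

text \<open>The sums of \<open>2 ^ n * \<bar>x n\<bar>\<close> form a Cauchy sequence, and their
  limit \<open>g\<close> dominates them almost everywhere, whence \<open>\<bar>x n\<bar>\<close> is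
  at most \<open>g / 2 ^ n\<close>. In the rate \<open>4 * K\<close>, one 2 pays for the weight
  \<open>2 ^ n\<close>, while the remaining \<open>2 * K\<close> absorbs the iterated quasi-triangle
  constant and still leaves decay.\<close>

lemma quasi_Banach_ideal_space_fast_null:
  assumes E: "quasi_Banach_ideal_space I E" and K: "quasi_triangle E K"
    and x: "\<And>n. x n \<in> elems E" "\<And>n. qnorm E (x n) \<le> 1 / (4 * K) ^ n"
  shows "AE t in lebesgue_on I. (\<lambda>n. x n t) \<longlonglongrightarrow> 0"
proof -
  have S: "solid_space I E"
    using E quasi_normed_ideal_space_solid unfolding quasi_Banach_ideal_space_def by blast
  have K1: "1 \<le> K" using K unfolding quasi_triangle_def by blast
  define f where "f n t = 2 ^ n * \<bar>x n t\<bar>" for n t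
  have f: "f n \<in> elems E" "qnorm E (f n) \<le> 1 / (2 * K) ^ n" for n
  proof -
    have [measurable]: "x n \<in> L0 I" using solid_space_L0[OF S x(1)] .
    have m: "f n \<in> L0 I" unfolding f_def by measurable
    have eq: "AE t in lebesgue_on I. \<bar>f n t\<bar> = \<bar>2 ^ n * x n t\<bar>" by (simp add: f_def abs_mult)
    note fn = solid_space_cong[OF S solid_space_scale(1)[OF S x(1)] m eq]
    show "f n \<in> elems E" by (rule fn)
    have "qnorm E (f n) = 2 ^ n * qnorm E (x n)"
      unfolding fn(2) solid_space_scale(2)[OF S x(1)] by simp
    also have "\<dots> \<le> 2 ^ n * (1 / (4 * K) ^ n)" using x(2) by (rule mult_left_mono) simp
    also have "(4 * K) ^ n = 2 ^ n * (2 * K) ^ n" using power_mult_distrib[of 2 "2 * K" n] by simp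
    finally show "qnorm E (f n) \<le> 1 / (2 * K) ^ n" by simp
  qed
  define T where "T n j t = (\<Sum>k<j. f (n + k) t)" for n j t
  \<comment> \<open>Splitting off the first term, not the last, applies \<open>K\<close> once per
    step; the bound reproduces itself because \<open>K * (1 + 1) = 2 * K\<close>.\<close>
  have T: "T n j \<in> elems E \<and> qnorm E (T n j) \<le> 2 * K / (2 * K) ^ n" for n j
  proof (induction j arbitrary: n)
    case 0
    then show ?case using solid_space_zero[OF S] K1 unfolding T_def by simp
  next
    case (Suc j)
    have eq: "T n (Suc j) = (\<lambda>t. f n t + T (Suc n) j t)"
      unfolding T_def sum.lessThan_Suc_shift by simp
    have "T n (Suc j) \<in> elems E" "qnorm E (T n (Suc j)) \<le> K * (qnorm E (f n) + qnorm E (T (Suc n) j))"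
      unfolding eq using K f(1) Suc unfolding quasi_triangle_def by blast+
    moreover have "K * (qnorm E (f n) + qnorm E (T (Suc n) j)) \<le> K * (1 / (2 * K) ^ n + 2 * K / (2 * K) ^ Suc n)"
      using K1 f(2)[of n] Suc[of "Suc n"] by (intro mult_left_mono add_mono) auto
    moreover have "K * (1 / (2 * K) ^ n + 2 * K / (2 * K) ^ Suc n) = 2 * K / (2 * K) ^ n"
      using K1 by (simp add: field_simps)
    ultimately show ?case by linarith
  qed
  have split: "T 0 (n + j) t = T 0 n t + T n j t" for n j t
    by (induction j) (simp_all add: T_def)
  have fpos: "0 \<le> f n t" for n t by (simp add: f_def)
  have Tpos: "0 \<le> T n j t" for n j t unfolding T_def by (intro sum_nonneg fpos)
  have lim: "(\<lambda>n. 2 * K / (2 * K) ^ n) \<longlonglongrightarrow> 0"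
  proof -
    have "(\<lambda>n. 2 * K * (1 / (2 * K)) ^ n) \<longlonglongrightarrow> 2 * K * 0"
      using K1 by (intro tendsto_mult_left LIMSEQ_realpow_zero) auto
    then show ?thesis by (simp add: power_one_over)
  qed
  have "\<forall>e>0. \<exists>N. \<forall>m\<ge>N. \<forall>n\<ge>N. qnorm E (\<lambda>t. T 0 m t - T 0 n t) < e"
  proof (intro allI impI)
    fix e :: real assume "0 < e"
    then obtain N where N: "\<And>n. n \<ge> N \<Longrightarrow> 2 * K / (2 * K) ^ n < e"
      using order_tendstoD(2)[OF lim, of e] unfolding eventually_sequentially by blast
    have le: "qnorm E (\<lambda>t. T 0 m t - T 0 n t) < e" if "N \<le> n" "n \<le> m" for m n
    proof -
      have "(\<lambda>t. T 0 m t - T 0 n t) = T n (m - n)"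
        using split[of n "m - n"] that by auto
      then show ?thesis using T[of n "m - n"] N[OF that(1)] by simp
    qed
    have "qnorm E (\<lambda>t. T 0 m t - T 0 n t) < e" if "N \<le> m" "N \<le> n" for m n
    proof (cases "n \<le> m")
      case False
      have eq: "(\<lambda>t. T 0 n t - T 0 m t) = T m (n - m)"
        using split[of m "n - m"] False by auto
      have "(\<lambda>t. T 0 m t - T 0 n t) = (\<lambda>t. - 1 * T m (n - m) t)"
        by (simp flip: eq)
      then have "qnorm E (\<lambda>t. T 0 m t - T 0 n t) = qnorm E (T m (n - m))"
        using solid_space_scale(2)[OF S, of "T m (n - m)" "-1"] T by simp
      also have "\<dots> < e" using le[of m n] that False eq by simp
      finally show ?thesis .
    qed (use le that in blast)
    then show "\<exists>N. \<forall>m\<ge>N. \<forall>n\<ge>N. qnorm E (\<lambda>t. T 0 m t - T 0 n t) < e" by blast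
  qed
  moreover have "\<forall>n. T 0 n \<in> elems E" using T by blast
  ultimately obtain g where g: "g \<in> elems E" "(\<lambda>n. qnorm E (\<lambda>t. T 0 n t - g t)) \<longlonglongrightarrow> 0"
    using E unfolding quasi_Banach_ideal_space_def by blast
  have "AE t in lebesgue_on I. T 0 k t \<le> g t" for k
  proof -
    \<comment> \<open>The part of a partial sum above \<open>g\<close> is dominated by the
      difference of every later partial sum and \<open>g\<close>. These differences tend to 0 in
      quasi-norm, so \<open>h\<close> has quasi-norm 0; no pointwise convergence enters.\<close>
    define h where "h t = max 0 (T 0 k t - g t)" for t
    have [measurable]: "g \<in> L0 I" "\<And>n. T 0 n \<in> L0 I" using solid_space_L0[OF S] g T by blast+
    have h: "h \<in> L0 I" unfolding h_def by measurable
    have le: "h \<in> elems E \<and> qnorm E h \<le> qnorm E (\<lambda>t. T 0 (k + j) t - g t)" for j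
    proof -
      have "(\<lambda>t. - 1 * g t) \<in> elems E" by (rule solid_space_scale(1)[OF S g(1)])
      then have "(\<lambda>t. T 0 (k + j) t + - 1 * g t) \<in> elems E"
        by (rule quasi_triangle_add[OF K conjunct1[OF T]])
      then have d: "(\<lambda>t. T 0 (k + j) t - g t) \<in> elems E" by simp
      have "AE t in lebesgue_on I. \<bar>h t\<bar> \<le> \<bar>T 0 (k + j) t - g t\<bar>"
      proof (rule AE_I2)
        fix t show "\<bar>h t\<bar> \<le> \<bar>T 0 (k + j) t - g t\<bar>"
          using split[of k j t] Tpos[of k j t] unfolding h_def by linarith
      qed
      from solid_space_ideal[OF S d h this] show ?thesis by blast
    qed
    have "qnorm E h \<le> 0"
    proof (rule LIMSEQ_le_const[OF g(2)], intro exI allI impI)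
      fix n assume "k \<le> n"
      then show "qnorm E h \<le> qnorm E (\<lambda>t. T 0 n t - g t)" using le[of "n - k"] by simp
    qed
    then have "qnorm E h = 0" using solid_space_nonneg[OF S, of h] le by force
    then have "AE t in lebesgue_on I. h t = 0" using solid_space_zeroD[OF S] le by blast
    then show ?thesis by eventually_elim (simp add: h_def max_def split: if_splits)
  qed
  then have "AE t in lebesgue_on I. \<forall>k. T 0 k t \<le> g t" by (simp add: AE_all_countable)
  then show ?thesis
  proof eventually_elim
    case (elim t)
    have le: "\<bar>x n t\<bar> \<le> g t * (1 / 2) ^ n" for n
    proof -
      have "T 0 (Suc n) t = T 0 n t + f n t" by (simp add: T_def)
      then have "f n t \<le> g t" using elim[rule_format, of "Suc n"] Tpos[of 0 n t] by linarith
      then show ?thesis by (simp add: f_def power_one_over field_simps)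
    qed
    have "(\<lambda>n. g t * (1 / 2) ^ n) \<longlonglongrightarrow> g t * 0"
      by (intro tendsto_mult_left LIMSEQ_realpow_zero) auto
    then have "(\<lambda>n. g t * (1 / 2) ^ n) \<longlonglongrightarrow> 0" by simp
    then show "(\<lambda>n. x n t) \<longlonglongrightarrow> 0"
      by (rule Lim_null_comparison[rotated]) (use le in \<open>auto intro!: always_eventually\<close>)
  qed
qed

text \<open>An element of quasi-norm 0 has factorizations with both factors as small as desired.
  Chosen at the rate of the preceding lemma, the two sequences of factors tend to 0 almost
  everywhere, while their product is constantly \<open>u\<close>. Balanced factors come with one
  bound, hence the common constant \<open>K\<close> for both spaces.\<close>

lemma product_space_solid:
  assumes E: "quasi_Banach_ideal_space I E" and F: "quasi_Banach_ideal_space I F"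
  shows "solid_space I (product_space I E F)"
proof -
  let ?P = "product_space I E F"
  have nE: "quasi_normed_ideal_space I E" and nF: "quasi_normed_ideal_space I F"
    using E F unfolding quasi_Banach_ideal_space_def by blast+
  note SE = quasi_normed_ideal_space_solid[OF nE] and SF = quasi_normed_ideal_space_solid[OF nF]
  obtain K1 where K1: "quasi_triangle E K1" using quasi_normed_ideal_space_triangle[OF nE] by blast
  obtain K2 where K2: "quasi_triangle F K2" using quasi_normed_ideal_space_triangle[OF nF] by blast
  define K where "K = max K1 K2"
  have mono: "quasi_triangle X L'" if "solid_space I X" "quasi_triangle X L" "L \<le> L'" for X L L'
    unfolding quasi_triangle_def
  proof (intro conjI ballI)
    show "1 \<le> L'" using that unfolding quasi_triangle_def by linarith
    fix x y assume xy: "x \<in> elems X" "y \<in> elems X"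
    then show "(\<lambda>t. x t + y t) \<in> elems X" using that unfolding quasi_triangle_def by blast
    have "qnorm X (\<lambda>t. x t + y t) \<le> L * (qnorm X x + qnorm X y)"
      using that xy unfolding quasi_triangle_def by blast
    also have "\<dots> \<le> L' * (qnorm X x + qnorm X y)"
      using that xy solid_space_nonneg[OF that(1)] by (intro mult_right_mono add_nonneg_nonneg) auto
    finally show "qnorm X (\<lambda>t. x t + y t) \<le> L' * (qnorm X x + qnorm X y)" .
  qed
  have K: "quasi_triangle E K" "quasi_triangle F K"
    using mono[OF SE K1] mono[OF SF K2] unfolding K_def by auto
  have K1: "1 \<le> K" using K unfolding quasi_triangle_def by blast
  have zero: "AE t in lebesgue_on I. u t = 0" if u: "u \<in> elems ?P" and q: "qnorm ?P u = 0" for u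
  proof -
    define a where "a n = (1 / (4 * K) ^ n)\<^sup>2" for n
    have a: "0 < a n" "sqrt (a n) = 1 / (4 * K) ^ n" for n unfolding a_def using K1 by simp_all
    have "\<exists>x y. x \<in> elems E \<and> y \<in> elems F \<and> (AE t in lebesgue_on I. u t = x t * y t) \<and>
       qnorm E x \<le> 1 / (4 * K) ^ n \<and> qnorm F y \<le> 1 / (4 * K) ^ n" for n
    proof -
      have "qnorm ?P u < a n" using q a(1) by simp
      then obtain x y where "x \<in> elems E" "y \<in> elems F" "AE t in lebesgue_on I. u t = x t * y t"
        "qnorm E x \<le> sqrt (a n)" "qnorm F y \<le> sqrt (a n)"
        by (rule product_space_factor[OF SE SF u])
      then show ?thesis unfolding a(2) by blast
    qed
    then have "\<forall>n. \<exists>x y. x \<in> elems E \<and> y \<in> elems F \<and> (AE t in lebesgue_on I. u t = x t * y t) \<and>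
       qnorm E x \<le> 1 / (4 * K) ^ n \<and> qnorm F y \<le> 1 / (4 * K) ^ n" ..
    then obtain x y where "\<forall>n. x n \<in> elems E \<and> y n \<in> elems F \<and>
       (AE t in lebesgue_on I. u t = x n t * y n t) \<and>
       qnorm E (x n) \<le> 1 / (4 * K) ^ n \<and> qnorm F (y n) \<le> 1 / (4 * K) ^ n"
      unfolding choice_iff by (elim exE)
    then have xy: "\<And>n. x n \<in> elems E" "\<And>n. y n \<in> elems F"
      "\<And>n. AE t in lebesgue_on I. u t = x n t * y n t"
      "\<And>n. qnorm E (x n) \<le> 1 / (4 * K) ^ n" "\<And>n. qnorm F (y n) \<le> 1 / (4 * K) ^ n"
      by blast+
    have "AE t in lebesgue_on I. (\<lambda>n. x n t) \<longlonglongrightarrow> 0"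
      by (rule quasi_Banach_ideal_space_fast_null[OF E K(1) xy(1,4)])
    moreover have "AE t in lebesgue_on I. (\<lambda>n. y n t) \<longlonglongrightarrow> 0"
      by (rule quasi_Banach_ideal_space_fast_null[OF F K(2) xy(2,5)])
    moreover have "AE t in lebesgue_on I. \<forall>n. u t = x n t * y n t" using xy(3) by (simp add: AE_all_countable)
    ultimately show ?thesis
    proof eventually_elim
      case (elim t)
      have "(\<lambda>n. x n t * y n t) \<longlonglongrightarrow> 0 * 0" using elim(1,2) by (rule tendsto_mult)
      moreover have "(\<lambda>n. x n t * y n t) = (\<lambda>n. u t)" using elim(3) by auto
      ultimately show "u t = 0" by (simp add: LIMSEQ_const_iff)
    qed
  qed
  have "(\<lambda>t. 0) \<in> elems ?P"
    by (rule product_space_le(1)[OF SE SF solid_space_zero(1)[OF SE] solid_space_zero(1)[OF SF]]) auto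
  then have ne: "elems ?P \<noteq> {}" by blast
  show ?thesis
    unfolding solid_space_def
  proof (intro conjI ballI allI impI)
    show "elems ?P \<subseteq> L0 I" using product_space_L0 by blast
  qed (rule ne product_space_nonneg[OF SE SF] zero product_space_scale[OF SE SF] product_space_ideal[OF SE SF];
    assumption)+
qed

section \<open>Symmetrizations\<close>

context half_line_interval
begin

lemma rearr_L0:
  assumes "AE t in lebesgue_on I. rearrangement I x t < \<infinity>"
  shows "rearr I x \<in> L0 I"
  using antimono_on_L0[OF antimono_on_rearr] rearrangement_finite[OF assms] by blast

lemma symmetrization_iff:
  "x \<in> elems (symmetrization I E) \<longleftrightarrow>
     x \<in> L0 I \<and> (\<forall>t\<in>I. rearrangement I x t < \<infinity>) \<and> rearr I x \<in> elems E"
proof -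
  have "(AE t in lebesgue_on I. rearrangement I x t < \<infinity>) \<longleftrightarrow> (\<forall>t\<in>I. rearrangement I x t < \<infinity>)"
  proof
    assume "\<forall>t\<in>I. rearrangement I x t < \<infinity>"
    then show "AE t in lebesgue_on I. rearrangement I x t < \<infinity>" by (intro AE_I2) simp
  qed (use rearrangement_finite in blast)
  then show ?thesis unfolding symmetrization_def by simp
qed

lemma qnorm_symmetrization: "qnorm (symmetrization I E) x = qnorm E (rearr I x)"
  unfolding symmetrization_def by simp

text \<open>A zero of the rearrangement at \<open>s\<close> bounds the measure of the support by
  \<open>s\<close>, and such zeros exist arbitrarily close to 0.\<close>

lemma rearrangement_zero:
  assumes x: "x \<in> L0 I" and fin: "\<And>t. t \<in> I \<Longrightarrow> rearrangement I x t < \<infinity>"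
    and zero: "AE t in lebesgue_on I. rearr I x t = 0"
  shows "AE t in lebesgue_on I. x t = 0"
proof -
  have le: "emeasure (lebesgue_on I) {s\<in>I. 0 < \<bar>x s\<bar>} \<le> ennreal e" if e: "0 < e" for e
  proof -
    obtain t where t: "t \<in> I" "t \<le> e" using I_below[OF e] by blast
    obtain s where s: "0 < s" "s < t" "rearr I x s = 0" using AE_I_ex_below[OF zero t(1)] by blast
    have "rearrangement I x s < \<infinity>" using fin I_down[OF t(1)] s by auto
    from emeasure_superlevel_rearr[OF x this] s
    have "emeasure (lebesgue_on I) {s\<in>I. 0 < \<bar>x s\<bar>} \<le> ennreal s" by simp
    also have "\<dots> \<le> ennreal e" using s t by (intro ennreal_leI) simp
    finally show ?thesis .
  qed
  have "emeasure (lebesgue_on I) {s\<in>I. 0 < \<bar>x s\<bar>} = 0"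
  proof -
    have "emeasure (lebesgue_on I) {s\<in>I. 0 < \<bar>x s\<bar>} \<le> 0"
      by (rule ennreal_le_epsilon) (use le in auto)
    then show ?thesis by simp
  qed
  then show ?thesis
    by (intro AE_I[where N = "{s\<in>I. 0 < \<bar>x s\<bar>}"] superlevel_sets x) auto
qed

lemma rearr_mono:
  assumes x: "x \<in> L0 I" and y: "y \<in> L0 I" and le: "AE t in lebesgue_on I. \<bar>x t\<bar> \<le> \<bar>y t\<bar>"
    and fin: "rearrangement I y t < \<infinity>"
  shows "rearrangement I x t < \<infinity>" "rearr I x t \<le> rearr I y t"
proof -
  have "emeasure (lebesgue_on I) {s\<in>I. rearr I y t < \<bar>x s\<bar>} \<le> emeasure (lebesgue_on I) {s\<in>I. rearr I y t < \<bar>y s\<bar>}"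
    by (rule emeasure_mono_AE) (use le in \<open>auto intro: superlevel_sets[OF y]\<close>)
  also have "\<dots> \<le> ennreal t" by (rule emeasure_superlevel_rearr[OF y fin])
  finally have "emeasure (lebesgue_on I) {s\<in>I. rearr I y t < \<bar>x s\<bar>} \<le> ennreal t" .
  from rearr_leI[OF x rearr_nonneg this]
  show "rearrangement I x t < \<infinity>" "rearr I x t \<le> rearr I y t" by auto
qed

lemma rearr_scale:
  assumes x: "x \<in> L0 I" and fin: "rearrangement I x t < \<infinity>"
  shows "rearrangement I (\<lambda>t. a * x t) t < \<infinity>" "rearr I (\<lambda>t. a * x t) t = \<bar>a\<bar> * rearr I x t"
proof -
  have [measurable]: "x \<in> L0 I" by fact
  have le: "rearrangement I (\<lambda>t. a * y t) t < \<infinity> \<and> rearr I (\<lambda>t. a * y t) t \<le> \<bar>a\<bar> * rearr I y t"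
    if y[measurable]: "y \<in> L0 I" and fin: "rearrangement I y t < \<infinity>" for y a
  proof -
    have m: "(\<lambda>t. a * y t) \<in> L0 I" by measurable
    have "emeasure (lebesgue_on I) {s\<in>I. \<bar>a\<bar> * rearr I y t < \<bar>a * y s\<bar>} \<le> emeasure (lebesgue_on I) {s\<in>I. rearr I y t < \<bar>y s\<bar>}"
      by (intro emeasure_mono superlevel_sets y) (auto simp: abs_mult mult_less_cancel_left)
    also have "\<dots> \<le> ennreal t" by (rule emeasure_superlevel_rearr[OF y fin])
    finally have "emeasure (lebesgue_on I) {s\<in>I. \<bar>a\<bar> * rearr I y t < \<bar>a * y s\<bar>} \<le> ennreal t" .
    from rearr_leI[OF m mult_nonneg_nonneg[OF abs_ge_zero rearr_nonneg] this] show ?thesis by blast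
  qed
  show fin': "rearrangement I (\<lambda>t. a * x t) t < \<infinity>" using le[OF x fin] by blast
  have m: "(\<lambda>t. a * x t) \<in> L0 I" by measurable
  show "rearr I (\<lambda>t. a * x t) t = \<bar>a\<bar> * rearr I x t"
  proof (cases "a = 0")
    case True
    have "rearr I (\<lambda>t. a * x t) t \<le> \<bar>a\<bar> * rearr I x t" using le[OF x fin, of a] by blast
    then have "rearr I (\<lambda>t. a * x t) t = 0"
      using True rearr_nonneg[of "\<lambda>t. a * x t" t] by (intro antisym) simp_all
    then show ?thesis using True by simp
  next
    case False
    have "rearr I x t = rearr I (\<lambda>t. (1 / a) * (a * x t)) t" using False by simp
    also have "\<dots> \<le> \<bar>1 / a\<bar> * rearr I (\<lambda>t. a * x t) t" using le[OF m fin', of "1 / a"] by blast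
    finally have "\<bar>a\<bar> * rearr I x t \<le> rearr I (\<lambda>t. a * x t) t" using False by (simp add: le_divide_eq mult.commute)
    then show ?thesis using le[OF x fin, of a] by simp
  qed
qed

lemma symmetrization_solid:
  assumes E: "solid_space I E"
  shows "solid_space I (symmetrization I E)"
  unfolding solid_space_def
proof (intro conjI ballI allI impI)
  let ?S = "symmetrization I E"
  show "elems ?S \<subseteq> L0 I" using symmetrization_iff by blast
  have mem: "rearr I x \<in> L0 I" if "\<forall>t\<in>I. rearrangement I x t < \<infinity>" for x
    using that by (intro rearr_L0 AE_I2) simp
  have "\<forall>t\<in>I. rearrangement I (\<lambda>t. 0) t < \<infinity> \<and> rearr I (\<lambda>t. 0) t = 0"
    using rearr_leI[of "\<lambda>t. 0" 0] by (auto intro!: antisym)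
  then have zero: "\<forall>t\<in>I. rearrangement I (\<lambda>t. 0) t < \<infinity>" "\<forall>t\<in>I. rearr I (\<lambda>t. 0) t = 0" by blast+
  then have "AE t in lebesgue_on I. \<bar>rearr I (\<lambda>t. 0) t\<bar> = \<bar>0\<bar>" by (intro AE_I2) simp
  then have "rearr I (\<lambda>t. 0) \<in> elems E"
    using solid_space_cong(1)[OF E solid_space_zero(1)[OF E] mem[OF zero(1)]] by blast
  then have "(\<lambda>t. 0) \<in> elems ?S" unfolding symmetrization_iff using zero(1) by simp
  then show "elems ?S \<noteq> {}" by blast
next
  fix x assume x: "x \<in> elems (symmetrization I E)"
  then show "0 \<le> qnorm (symmetrization I E) x"
    unfolding symmetrization_iff qnorm_symmetrization using solid_space_nonneg[OF E] by blast
  assume "qnorm (symmetrization I E) x = 0"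
  then have "AE t in lebesgue_on I. rearr I x t = 0"
    using x unfolding symmetrization_iff qnorm_symmetrization using solid_space_zeroD[OF E] by blast
  then show "AE t in lebesgue_on I. x t = 0"
    using x unfolding symmetrization_iff using rearrangement_zero by blast
next
  fix a x assume x: "x \<in> elems (symmetrization I E)"
  then have x': "x \<in> L0 I" "\<forall>t\<in>I. rearrangement I x t < \<infinity>" "rearr I x \<in> elems E"
    unfolding symmetrization_iff by auto
  have [measurable]: "x \<in> L0 I" by fact
  have ax: "(\<lambda>t. a * x t) \<in> L0 I" by measurable
  have fin: "\<forall>t\<in>I. rearrangement I (\<lambda>t. a * x t) t < \<infinity>"
    using rearr_scale(1)[OF x'(1)] x'(2) by blast
  have m: "rearr I (\<lambda>t. a * x t) \<in> L0 I" using fin by (intro rearr_L0 AE_I2) simp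
  have eq: "AE t in lebesgue_on I. \<bar>rearr I (\<lambda>t. a * x t) t\<bar> = \<bar>a * rearr I x t\<bar>"
    using rearr_scale(2)[OF x'(1)] x'(2) by (intro AE_I2) (simp add: abs_mult)
  note ax' = solid_space_cong[OF E solid_space_scale(1)[OF E x'(3)] m eq]
  show "(\<lambda>t. a * x t) \<in> elems (symmetrization I E)"
    unfolding symmetrization_iff using ax fin ax' by blast
  show "qnorm (symmetrization I E) (\<lambda>t. a * x t) = \<bar>a\<bar> * qnorm (symmetrization I E) x"
    unfolding qnorm_symmetrization ax'(2) solid_space_scale(2)[OF E x'(3)] ..
next
  fix x y assume y: "y \<in> elems (symmetrization I E)" and x: "x \<in> L0 I"
    and le: "AE t in lebesgue_on I. \<bar>x t\<bar> \<le> \<bar>y t\<bar>"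
  then have y': "y \<in> L0 I" "\<forall>t\<in>I. rearrangement I y t < \<infinity>" "rearr I y \<in> elems E"
    unfolding symmetrization_iff by auto
  have fin: "\<forall>t\<in>I. rearrangement I x t < \<infinity>"
    using rearr_mono(1)[OF x y'(1) le] y'(2) by blast
  have m: "rearr I x \<in> L0 I" using fin by (intro rearr_L0 AE_I2) simp
  have le': "AE t in lebesgue_on I. \<bar>rearr I x t\<bar> \<le> \<bar>rearr I y t\<bar>"
    using rearr_mono(2)[OF x y'(1) le] y'(2) by (intro AE_I2) simp
  note x' = solid_space_ideal[OF E y'(3) m le']
  show "x \<in> elems (symmetrization I E)" unfolding symmetrization_iff using x fin x' by blast
  show "qnorm (symmetrization I E) x \<le> qnorm (symmetrization I E) y"
    unfolding qnorm_symmetrization by (rule x')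
qed

section \<open>Dilations, sums and products of rearrangements, and the first inclusion\<close>

text \<open>A nonnegative decreasing function agrees almost everywhere with its rearrangement, so it
  belongs to \<open>decreasing_cone\<close>. In this form the dilation bound applies both to
  rearrangements and to Hardy transforms.\<close>

lemma D2_bound_decreasing:
  assumes A: "D2_bound I E A" and h: "antimono_on I h" "\<And>t. t \<in> I \<Longrightarrow> 0 \<le> h t" "h \<in> elems E"
  shows "D2 h \<in> elems E" "qnorm E (D2 h) \<le> A * qnorm E h"
proof -
  have "AE t in lebesgue_on I. rearrangement I h t = ereal (h t)"
    using h(2) by (rule rearrangement_antimono_on[OF h(1)])
  then have "AE t in lebesgue_on I. ereal (h t) = rearrangement I h t" by eventually_elim simp
  then have "h \<in> decreasing_cone I E" unfolding decreasing_cone_def using h(3) by blast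
  then show "D2 h \<in> elems E" "qnorm E (D2 h) \<le> A * qnorm E h" using A unfolding D2_bound_def by blast+
qed

lemma D2_rearr:
  assumes "D2_bound I E A" "x \<in> elems (symmetrization I E)"
  shows "D2 (rearr I x) \<in> elems E" "qnorm E (D2 (rearr I x)) \<le> A * qnorm (symmetrization I E) x"
  using assms(2) D2_bound_decreasing[OF assms(1) antimono_on_rearr]
  unfolding symmetrization_iff qnorm_symmetrization by auto

text \<open>The common origin of the dilations: each of \<open>x\<close> and \<open>y\<close>
  exceeds its rearrangement at \<open>t / 2\<close> on a set of measure at most
  \<open>t / 2\<close>, and outside the union of the two sets \<open>z\<close> is bounded by
  \<open>d\<close>.\<close>

lemma emeasure_half_half:
  fixes z :: "real \<Rightarrow> real"
  assumes x: "x \<in> L0 I" and y: "y \<in> L0 I" and t: "t \<in> I"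
    and fin: "rearrangement I x (t / 2) < \<infinity>" "rearrangement I y (t / 2) < \<infinity>"
    and sub: "\<And>s. s \<in> I \<Longrightarrow> \<bar>x s\<bar> \<le> rearr I x (t / 2) \<Longrightarrow> \<bar>y s\<bar> \<le> rearr I y (t / 2) \<Longrightarrow> \<bar>z s\<bar> \<le> d"
  shows "emeasure (lebesgue_on I) {s\<in>I. d < \<bar>z s\<bar>} \<le> ennreal t"
proof -
  let ?A = "{s\<in>I. rearr I x (t / 2) < \<bar>x s\<bar>}" and ?B = "{s\<in>I. rearr I y (t / 2) < \<bar>y s\<bar>}"
  note [simp] = superlevel_sets[OF x] superlevel_sets[OF y]
  have "emeasure (lebesgue_on I) {s\<in>I. d < \<bar>z s\<bar>} \<le> emeasure (lebesgue_on I) (?A \<union> ?B)"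
  proof (rule emeasure_mono)
    show "{s\<in>I. d < \<bar>z s\<bar>} \<subseteq> ?A \<union> ?B"
    proof
      fix s assume "s \<in> {s\<in>I. d < \<bar>z s\<bar>}"
      then show "s \<in> ?A \<union> ?B" using sub[of s] by (cases "\<bar>x s\<bar> \<le> rearr I x (t / 2)"; cases "\<bar>y s\<bar> \<le> rearr I y (t / 2)") auto
    qed
    show "?A \<union> ?B \<in> sets (lebesgue_on I)" by (intro sets.Un superlevel_sets x y)
  qed
  also have "\<dots> \<le> emeasure (lebesgue_on I) ?A + emeasure (lebesgue_on I) ?B"
    by (rule emeasure_subadditive) simp_all
  also have "\<dots> \<le> ennreal (t / 2) + ennreal (t / 2)"
    using emeasure_superlevel_rearr[OF x fin(1)] emeasure_superlevel_rearr[OF y fin(2)] by (rule add_mono)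
  also have "\<dots> = ennreal t" using I_pos[OF t] by (simp flip: ennreal_plus)
  finally show ?thesis .
qed

lemma rearr_mult_le:
  assumes x: "x \<in> L0 I" and y: "y \<in> L0 I" and t: "t \<in> I"
    and fin: "rearrangement I x (t / 2) < \<infinity>" "rearrangement I y (t / 2) < \<infinity>"
  shows "rearrangement I (\<lambda>s. x s * y s) t < \<infinity>"
    "rearr I (\<lambda>s. x s * y s) t \<le> D2 (rearr I x) t * D2 (rearr I y) t"
proof -
  have [measurable]: "x \<in> L0 I" "y \<in> L0 I" by fact+
  have m: "(\<lambda>s. x s * y s) \<in> L0 I" by measurable
  have "emeasure (lebesgue_on I) {s\<in>I. rearr I x (t / 2) * rearr I y (t / 2) < \<bar>x s * y s\<bar>} \<le> ennreal t"
    by (rule emeasure_half_half[OF x y t fin]) (auto simp: abs_mult intro: mult_mono)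
  from rearr_leI[OF m _ this]
  show "rearrangement I (\<lambda>s. x s * y s) t < \<infinity>"
    "rearr I (\<lambda>s. x s * y s) t \<le> D2 (rearr I x) t * D2 (rearr I y) t" by (simp_all add: D2_def)
qed

lemma rearr_add_le:
  assumes x: "x \<in> L0 I" and y: "y \<in> L0 I" and t: "t \<in> I"
    and fin: "rearrangement I x (t / 2) < \<infinity>" "rearrangement I y (t / 2) < \<infinity>"
  shows "rearrangement I (\<lambda>s. x s + y s) t < \<infinity>"
    "rearr I (\<lambda>s. x s + y s) t \<le> D2 (rearr I x) t + D2 (rearr I y) t"
proof -
  have [measurable]: "x \<in> L0 I" "y \<in> L0 I" by fact+
  have m: "(\<lambda>s. x s + y s) \<in> L0 I" by measurable
  have "emeasure (lebesgue_on I) {s\<in>I. rearr I x (t / 2) + rearr I y (t / 2) < \<bar>x s + y s\<bar>} \<le> ennreal t"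
    by (rule emeasure_half_half[OF x y t fin]) auto
  from rearr_leI[OF m _ this]
  show "rearrangement I (\<lambda>s. x s + y s) t < \<infinity>"
    "rearr I (\<lambda>s. x s + y s) t \<le> D2 (rearr I x) t + D2 (rearr I y) t" by (simp_all add: D2_def)
qed

text \<open>The rearrangement of a sum is at most the sum of the dilated rearrangements;
  \<open>K\<close> comes from adding in E and \<open>A\<close> from the dilations.\<close>

lemma symmetrization_triangle:
  assumes E: "solid_space I E" and K: "quasi_triangle E K" and A: "D2_bound I E A"
  shows "quasi_triangle (symmetrization I E) (K * A)"
  unfolding quasi_triangle_def
proof (intro conjI ballI)
  have KA: "1 \<le> K" "1 \<le> A" using K A unfolding quasi_triangle_def D2_bound_def by blast+
  then show "1 \<le> K * A" using mult_mono[of 1 K 1 A] by simp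
  fix x y assume xS: "x \<in> elems (symmetrization I E)" and yS: "y \<in> elems (symmetrization I E)"
  then have x: "x \<in> L0 I" "\<forall>t\<in>I. rearrangement I x t < \<infinity>"
    and y: "y \<in> L0 I" "\<forall>t\<in>I. rearrangement I y t < \<infinity>"
    unfolding symmetrization_iff by auto
  have [measurable]: "x \<in> L0 I" "y \<in> L0 I" by fact+
  have m: "(\<lambda>s. x s + y s) \<in> L0 I" by measurable
  note le = rearr_add_le[OF x(1) y(1)]
  have fin: "\<forall>t\<in>I. rearrangement I (\<lambda>s. x s + y s) t < \<infinity>"
    using le(1) x(2) y(2) I_half by blast
  have rm: "rearr I (\<lambda>s. x s + y s) \<in> L0 I" using fin by (intro rearr_L0 AE_I2) simp
  note Dx = D2_rearr[OF A xS] and Dy = D2_rearr[OF A yS]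
  have s: "(\<lambda>t. D2 (rearr I x) t + D2 (rearr I y) t) \<in> elems E"
    "qnorm E (\<lambda>t. D2 (rearr I x) t + D2 (rearr I y) t) \<le> K * (qnorm E (D2 (rearr I x)) + qnorm E (D2 (rearr I y)))"
    using K Dx(1) Dy(1) unfolding quasi_triangle_def by blast+
  have le': "AE t in lebesgue_on I. \<bar>rearr I (\<lambda>s. x s + y s) t\<bar> \<le> \<bar>D2 (rearr I x) t + D2 (rearr I y) t\<bar>"
  proof (rule AE_I2)
    fix t assume "t \<in> space (lebesgue_on I)"
    then have "rearr I (\<lambda>s. x s + y s) t \<le> D2 (rearr I x) t + D2 (rearr I y) t"
      using le(2) x(2) y(2) I_half by simp
    then show "\<bar>rearr I (\<lambda>s. x s + y s) t\<bar> \<le> \<bar>D2 (rearr I x) t + D2 (rearr I y) t\<bar>"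
      using rearr_nonneg[of "\<lambda>s. x s + y s" t] by linarith
  qed
  note i = solid_space_ideal[OF E s(1) rm le']
  show "(\<lambda>t. x t + y t) \<in> elems (symmetrization I E)"
    unfolding symmetrization_iff using m fin i(1) by blast
  have "qnorm (symmetrization I E) (\<lambda>t. x t + y t) \<le> K * (qnorm E (D2 (rearr I x)) + qnorm E (D2 (rearr I y)))"
    unfolding qnorm_symmetrization using i(2) s(2) by simp
  also have "\<dots> \<le> K * (A * qnorm (symmetrization I E) x + A * qnorm (symmetrization I E) y)"
    using Dx(2) Dy(2) KA by (intro mult_left_mono add_mono) auto
  also have "\<dots> = K * A * (qnorm (symmetrization I E) x + qnorm (symmetrization I E) y)"
    by (simp add: algebra_simps)
  finally show "qnorm (symmetrization I E) (\<lambda>t. x t + y t) \<le> \<dots>" .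
qed

lemma product_of_symmetrizations:
  assumes E: "solid_space I E" and F: "solid_space I F"
    and A: "D2_bound I E A" and B: "D2_bound I F B"
  shows "embeds_with (product_space I (symmetrization I E) (symmetrization I F))
    (symmetrization I (product_space I E F)) (A * B)"
  unfolding embeds_with_def
proof (intro conjI subsetI ballI)
  let ?SE = "symmetrization I E" and ?SF = "symmetrization I F"
  let ?P = "product_space I ?SE ?SF" and ?S = "symmetrization I (product_space I E F)"
  note SE = symmetrization_solid[OF E] and SF = symmetrization_solid[OF F]
  fix u assume u: "u \<in> elems ?P"
  have *: "u \<in> elems ?S \<and> qnorm ?S u \<le> A * B * a" if a: "qnorm ?P u < a" for a
  proof -
    obtain x y where xy: "x \<in> elems ?SE" "y \<in> elems ?SF" "AE t in lebesgue_on I. u t = x t * y t"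
      "qnorm ?SE x \<le> sqrt a" "qnorm ?SF y \<le> sqrt a"
      using product_space_factor[OF SE SF u a] .
    have a0: "0 < a" using product_space_nonneg[OF SE SF u] a by simp
    have AB: "1 \<le> A" "1 \<le> B" using A B unfolding D2_bound_def by blast+
    have x: "x \<in> L0 I" "\<forall>t\<in>I. rearrangement I x t < \<infinity>"
      and y: "y \<in> L0 I" "\<forall>t\<in>I. rearrangement I y t < \<infinity>"
      using xy(1,2) unfolding symmetrization_iff by auto
    have um: "u \<in> L0 I" using product_space_L0[OF u] .
    have [measurable]: "x \<in> L0 I" "y \<in> L0 I" by fact+
    have m: "(\<lambda>s. x s * y s) \<in> L0 I" by measurable
    have AEu: "AE t in lebesgue_on I. \<bar>u t\<bar> \<le> \<bar>x t * y t\<bar>" using xy(3) by eventually_elim simp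
    note le = rearr_mult_le[OF x(1) y(1)]
    have fin: "\<forall>t\<in>I. rearrangement I (\<lambda>s. x s * y s) t < \<infinity>"
      using le(1) x(2) y(2) I_half by blast
    have finu: "\<forall>t\<in>I. rearrangement I u t < \<infinity>"
      using rearr_mono(1)[OF um m AEu] fin by blast
    have rm: "rearr I u \<in> L0 I" using finu by (intro rearr_L0 AE_I2) simp
    note Dx = D2_rearr[OF A xy(1)] and Dy = D2_rearr[OF B xy(2)]
    have le': "AE t in lebesgue_on I. \<bar>rearr I u t\<bar> \<le> \<bar>D2 (rearr I x) t\<bar> * \<bar>D2 (rearr I y) t\<bar>"
    proof (rule AE_I2)
      fix t assume "t \<in> space (lebesgue_on I)"
      then have "rearr I (\<lambda>s. x s * y s) t \<le> D2 (rearr I x) t * D2 (rearr I y) t"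
        "rearr I u t \<le> rearr I (\<lambda>s. x s * y s) t"
        using le(2) x(2) y(2) I_half rearr_mono(2)[OF um m AEu] fin by simp_all
      moreover have "0 \<le> D2 (rearr I x) t" "0 \<le> D2 (rearr I y) t" by (simp_all add: D2_def)
      ultimately show "\<bar>rearr I u t\<bar> \<le> \<bar>D2 (rearr I x) t\<bar> * \<bar>D2 (rearr I y) t\<bar>" by simp
    qed
    note pl = product_space_le[OF E F Dx(1) Dy(1) rm le']
    have "qnorm E (D2 (rearr I x)) * qnorm F (D2 (rearr I y)) \<le> (A * sqrt a) * (B * sqrt a)"
    proof (rule mult_mono)
      show "qnorm E (D2 (rearr I x)) \<le> A * sqrt a"
        using Dx(2) mult_left_mono[OF xy(4), of A] AB by linarith
      show "qnorm F (D2 (rearr I y)) \<le> B * sqrt a"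
        using Dy(2) mult_left_mono[OF xy(5), of B] AB by linarith
    qed (use AB a0 solid_space_nonneg[OF F Dy(1)] in auto)
    also have "\<dots> = A * B * a" using a0 by simp
    finally have "qnorm ?S u \<le> A * B * a" unfolding qnorm_symmetrization using pl(2) by simp
    moreover have "u \<in> elems ?S" unfolding symmetrization_iff using um finu pl(1) by blast
    ultimately show ?thesis by blast
  qed
  show "u \<in> elems ?S" using *[OF less_add_one] by blast
  show "qnorm ?S u \<le> A * B * qnorm ?P u"
  proof (rule dense_ge)
    have AB: "1 \<le> A" "1 \<le> B" using A B unfolding D2_bound_def by blast+
    fix b assume b: "A * B * qnorm ?P u < b"
    then have "qnorm ?P u < b / (A * B)" using AB by (simp add: less_divide_eq mult.commute)
    with *[of "b / (A * B)"] AB show "qnorm ?S u \<le> b" by simp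
  qed
qed

section \<open>Squares under symmetrization\<close>

text \<open>The set where the square exceeds \<open>d\<^sup>2\<close> is the set where
  \<open>\<bar>x\<bar>\<close> exceeds \<open>d\<close>, so admissible levels are squared along with
  the function.\<close>

lemma rearr_power2:
  assumes x: "x \<in> L0 I"
  shows "rearrangement I (\<lambda>s. (x s)\<^sup>2) t < \<infinity> \<longleftrightarrow> rearrangement I x t < \<infinity>"
    "rearr I (\<lambda>s. (x s)\<^sup>2) t = (rearr I x t)\<^sup>2"
proof -
  have [measurable]: "x \<in> L0 I" by fact
  have m: "(\<lambda>s. (x s)\<^sup>2) \<in> L0 I" by measurable
  have set: "{s\<in>I. d\<^sup>2 < \<bar>(x s)\<^sup>2\<bar>} = {s\<in>I. d < \<bar>x s\<bar>}" if "0 \<le> d" for d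
    using that abs_square_le_1 power2_le_iff_abs_le by (auto simp flip: not_le) 
  have iff: "rearrangement I (\<lambda>s. (x s)\<^sup>2) t \<le> ereal (d\<^sup>2) \<longleftrightarrow> rearrangement I x t \<le> ereal d" if "0 \<le> d" for d
    using rearrangement_le_iff[OF m, of "d\<^sup>2" t] rearrangement_le_iff[OF x that, of t] set[OF that] by simp
  show fin: "rearrangement I (\<lambda>s. (x s)\<^sup>2) t < \<infinity> \<longleftrightarrow> rearrangement I x t < \<infinity>"
  proof
    assume *: "rearrangement I (\<lambda>s. (x s)\<^sup>2) t < \<infinity>"
    have "rearrangement I (\<lambda>s. (x s)\<^sup>2) t \<le> ereal ((sqrt (rearr I (\<lambda>s. (x s)\<^sup>2) t))\<^sup>2)"
      using rearrangement_rearr[OF *] by simp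
    then have "rearrangement I x t \<le> ereal (sqrt (rearr I (\<lambda>s. (x s)\<^sup>2) t))" using iff[of "sqrt (rearr I (\<lambda>s. (x s)\<^sup>2) t)"] by simp
    then show "rearrangement I x t < \<infinity>" by (rule order_le_less_trans) simp
  next
    assume *: "rearrangement I x t < \<infinity>"
    have "rearrangement I x t \<le> ereal (rearr I x t)" using rearrangement_rearr[OF *] by simp
    then have "rearrangement I (\<lambda>s. (x s)\<^sup>2) t \<le> ereal ((rearr I x t)\<^sup>2)" using iff[of "rearr I x t"] by simp
    then show "rearrangement I (\<lambda>s. (x s)\<^sup>2) t < \<infinity>" by (rule order_le_less_trans) simp
  qed
  show "rearr I (\<lambda>s. (x s)\<^sup>2) t = (rearr I x t)\<^sup>2"
  proof (cases "rearrangement I x t < \<infinity>")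
    case True
    then have "rearrangement I (\<lambda>s. (x s)\<^sup>2) t < \<infinity>" using fin by simp
    note r = rearrangement_rearr[OF True] rearrangement_rearr[OF this]
    show ?thesis
    proof (rule antisym)
      show "rearr I (\<lambda>s. (x s)\<^sup>2) t \<le> (rearr I x t)\<^sup>2" using iff[of "rearr I x t"] r by simp
      have "rearr I x t \<le> sqrt (rearr I (\<lambda>s. (x s)\<^sup>2) t)"
        using iff[of "sqrt (rearr I (\<lambda>s. (x s)\<^sup>2) t)"] r by simp
      then show "(rearr I x t)\<^sup>2 \<le> rearr I (\<lambda>s. (x s)\<^sup>2) t"
        using power_mono[of "rearr I x t" "sqrt (rearr I (\<lambda>s. (x s)\<^sup>2) t)" 2] by simp
    qed
  next
    case False
    then have "rearrangement I x t = \<infinity>" "rearrangement I (\<lambda>s. (x s)\<^sup>2) t = \<infinity>" using fin by auto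
    \<comment> \<open>Both real values are the default 0 that stands for infinity, and 0 is its own
      square.\<close>
    then show ?thesis by (simp add: rearr_def)
  qed
qed

lemma symmetrization_square_root:
  assumes K: "square_root_of I K P"
  shows "square_root_of I (symmetrization I K) (symmetrization I P)"
  unfolding square_root_of_def
proof (intro conjI ballI impI)
  show "elems (symmetrization I K) \<subseteq> L0 I" using symmetrization_iff by blast
  fix x assume x[measurable]: "x \<in> L0 I"
  have m: "(\<lambda>t. (x t)\<^sup>2) \<in> L0 I" by measurable
  have r: "rearr I (\<lambda>s. (x s)\<^sup>2) = (\<lambda>t. (rearr I x t)\<^sup>2)" using rearr_power2(2)[OF x] by blast
  have rL0: "rearr I x \<in> L0 I" if "\<forall>t\<in>I. rearrangement I x t < \<infinity>"
    using that by (intro rearr_L0 AE_I2) simp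
  show "(x \<in> elems (symmetrization I K)) = ((\<lambda>t. (x t)\<^sup>2) \<in> elems (symmetrization I P))"
    unfolding symmetrization_iff r rearr_power2(1)[OF x]
    using x m rL0 square_root_ofD(2)[OF K] square_root_ofI[OF K] by blast
  assume "x \<in> elems (symmetrization I K)"
  then have "rearr I x \<in> elems K" unfolding symmetrization_iff by blast
  from square_root_ofD(3)[OF K this]
  show "qnorm (symmetrization I K) x = sqrt (qnorm (symmetrization I P) (\<lambda>t. (x t)\<^sup>2))"
    unfolding qnorm_symmetrization r .
qed

section \<open>Nontriviality of the product\<close>

text \<open>The rearrangement of an element that does not vanish almost everywhere has a positive
  value \<open>d\<close> at some \<open>b\<close>, and by monotonicity it is at least
  \<open>d\<close> on (0, b); divided by \<open>d\<close> it dominates the indicator. All smaller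
  intervals are included so that one interval can serve E and F together.\<close>

lemma indicator_in_symmetrization:
  assumes E: "solid_space I E" and ne: "elems (symmetrization I E) \<noteq> null_class I"
  obtains b where "0 < b" "\<And>a. 0 < a \<Longrightarrow> a \<le> b \<Longrightarrow> indicat_real {0<..<a} \<in> elems (symmetrization I E)"
proof -
  note SE = symmetrization_solid[OF E]
  have "null_class I \<subseteq> elems (symmetrization I E)"
  proof
    fix x assume "x \<in> null_class I"
    then have "x \<in> L0 I" and "AE t in lebesgue_on I. x t = 0" unfolding null_class_def by auto
    moreover from this(2) have "AE t in lebesgue_on I. \<bar>x t\<bar> \<le> \<bar>0\<bar>" by eventually_elim simp
    ultimately show "x \<in> elems (symmetrization I E)"
      using solid_space_ideal(1)[OF SE solid_space_zero(1)[OF SE]] by blast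
  qed
  then obtain x where xS: "x \<in> elems (symmetrization I E)" and xn: "x \<notin> null_class I" using ne by blast
  have x: "x \<in> L0 I" "\<forall>t\<in>I. rearrangement I x t < \<infinity>" "rearr I x \<in> elems E"
    using xS unfolding symmetrization_iff by auto
  have "\<not> (AE t in lebesgue_on I. x t = 0)" using x(1) xn unfolding null_class_def by blast
  then have "\<not> (AE t in lebesgue_on I. rearr I x t = 0)" using rearrangement_zero[OF x(1)] x(2) by blast
  then obtain b where b: "b \<in> I" "rearr I x b \<noteq> 0"
    by (metis (mono_tags, lifting) AE_I2 space_lebesgue_on)
  define d where "d = rearr I x b"
  have d: "0 < d" using b rearr_nonneg[of x b] unfolding d_def by linarith
  have anti: "antimono_on I (rearr I x)" using antimono_on_rearr x(2) by blast
  show thesis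
  proof (rule that)
    show "0 < b" using I_pos b by blast
    fix a assume a: "0 < a" "a \<le> b"
    then have aI: "a \<in> I" using I_down b by blast
    let ?f = "indicat_real {0<..<a}"
    have f: "antimono_on I ?f"
      unfolding monotone_on_def using I_pos by (auto simp: indicator_def)
    have m: "?f \<in> L0 I" by (rule antimono_on_L0[OF f])
    have le: "AE t in lebesgue_on I. \<bar>?f t\<bar> \<le> \<bar>1 / d * rearr I x t\<bar>"
    proof (rule AE_I2)
      fix t assume "t \<in> space (lebesgue_on I)"
      then have t: "t \<in> I" by simp
      show "\<bar>?f t\<bar> \<le> \<bar>1 / d * rearr I x t\<bar>"
      proof (cases "t < a")
        case True
        then have "d \<le> rearr I x t" using anti a t b unfolding d_def monotone_on_def by auto
        then show ?thesis using d by (simp add: indicator_def)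
      qed simp
    qed
    have fE: "?f \<in> elems E" by (rule solid_space_ideal(1)[OF E solid_space_scale(1)[OF E x(3)] m le])
    have re: "AE t in lebesgue_on I. rearrangement I ?f t = ereal (?f t)"
      by (rule rearrangement_antimono_on[OF f]) simp
    then have fin: "AE t in lebesgue_on I. rearrangement I ?f t < \<infinity>" by eventually_elim simp
    have eq: "AE t in lebesgue_on I. \<bar>rearr I ?f t\<bar> = \<bar>?f t\<bar>"
      using re by eventually_elim (simp add: rearr_def)
    have "rearr I ?f \<in> elems E"
      by (rule solid_space_cong(1)[OF E fE rearr_L0[OF fin] eq])
    then show "?f \<in> elems (symmetrization I E)" unfolding symmetrization_def using m fin by simp
  qed
qed

text \<open>The indicator of a short initial interval lies in both symmetrizations and is its own
  square.\<close>

lemma product_of_symmetrizations_nontrivial: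
  assumes E: "solid_space I E" and F: "solid_space I F"
    and ne: "elems (symmetrization I E) \<noteq> null_class I" "elems (symmetrization I F) \<noteq> null_class I"
  shows "elems (product_space I (symmetrization I E) (symmetrization I F)) \<noteq> null_class I"
proof -
  note SE = symmetrization_solid[OF E] and SF = symmetrization_solid[OF F]
  obtain b where b: "0 < b" "\<And>a. 0 < a \<Longrightarrow> a \<le> b \<Longrightarrow> indicat_real {0<..<a} \<in> elems (symmetrization I E)"
    by (rule indicator_in_symmetrization[OF E ne(1)]) blast
  obtain c where c: "0 < c" "\<And>a. 0 < a \<Longrightarrow> a \<le> c \<Longrightarrow> indicat_real {0<..<a} \<in> elems (symmetrization I F)"
    by (rule indicator_in_symmetrization[OF F ne(2)]) blast
  obtain a where a: "a \<in> I" "a \<le> min b c" using I_below[of "min b c"] b c by auto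
  let ?f = "indicat_real {0<..<a}"
  have f: "?f \<in> elems (symmetrization I E)" "?f \<in> elems (symmetrization I F)"
    using b c a I_pos by auto
  have "?f \<in> elems (product_space I (symmetrization I E) (symmetrization I F))"
    by (rule product_space_le(1)[OF SE SF f solid_space_L0[OF SE f(1)]]) (auto simp: indicator_def)
  moreover have "?f \<notin> null_class I"
  proof
    assume "?f \<in> null_class I"
    then have "AE t in lebesgue_on I. ?f t = 0" unfolding null_class_def by blast
    from AE_I_ex_below[OF this a(1)] show False by (auto simp: indicator_def split: if_splits)
  qed
  ultimately show ?thesis by blast
qed

section \<open>The Hardy operator\<close>

text \<open>For each fixed function the estimate passes to the infimum of the admissible constants,
  so the best constant is itself admissible.\<close>

lemma D2_const_bound:
  assumes E: "solid_space I E" and "D2_bounded I E"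
  shows "D2_bound I E (D2_const I E)"
proof -
  let ?S = "{A. D2_bound I E A}"
  obtain A where A: "D2_bound I E A" using assms(2) unfolding D2_bounded_def by blast
  then have ne: "?S \<noteq> {}" by blast
  have "1 \<le> Inf ?S" using ne by (intro cInf_greatest) (auto simp: D2_bound_def)
  moreover have "qnorm E (D2 x) \<le> Inf ?S * qnorm E x" if x: "x \<in> decreasing_cone I E" for x
  proof (rule le_cInf_mult[OF ne])
    show "0 \<le> qnorm E x" using x solid_space_nonneg[OF E] unfolding decreasing_cone_def by blast
  qed (use x in \<open>auto simp: D2_bound_def\<close>)
  moreover have "D2 x \<in> elems E" if "x \<in> decreasing_cone I E" for x
    using A that unfolding D2_bound_def by blast
  ultimately show ?thesis unfolding D2_bound_def D2_const_def by blast
qed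

lemma hardy_norm_bound:
  assumes E: "solid_space I E" and "hardy_bounded I r E"
  shows "hardy_bound I r E (hardy_norm I r E)"
proof -
  let ?S = "{C. hardy_bound I r E C}"
  obtain C where C: "hardy_bound I r E C" using assms(2) unfolding hardy_bounded_def by blast
  then have ne: "?S \<noteq> {}" by blast
  have "0 \<le> Inf ?S" using ne by (intro cInf_greatest) (auto simp: hardy_bound_def)
  moreover have "qnorm E (hardy I r x) \<le> Inf ?S * qnorm E x" if x: "x \<in> elems E" for x
  proof (rule le_cInf_mult[OF ne])
    show "0 \<le> qnorm E x" using x solid_space_nonneg[OF E] by blast
  qed (use x in \<open>auto simp: hardy_bound_def\<close>)
  moreover have "(AE t in lebesgue_on I. hardy_integral I r x t < \<infinity>) \<and> hardy I r x \<in> elems E"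
    if "x \<in> elems E" for x
    using C that unfolding hardy_bound_def by blast
  ultimately show ?thesis unfolding hardy_bound_def hardy_norm_def by blast
qed

section \<open>Monotonicity of the Hardy transform and the pointwise estimate\<close>

lemma hardy_integral_antimono:
  assumes "s \<le> t"
  shows "hardy_integral I r x t \<le> hardy_integral I r x s"
proof -
  have eq: "hardy_integral I r x u =
      (\<integral>\<^sup>+ v. ennreal (\<bar>x v\<bar> powr r / v) * indicator (I \<inter> {u<..}) v \<partial>lebesgue)" for u
    unfolding hardy_integral_def by (rule nn_integral_restrict_space) auto
  show ?thesis
    unfolding eq using assms by (intro nn_integral_mono mult_left_mono) (auto simp: indicator_def)
qed

lemma hardy_integral_finite:
  assumes "AE t in lebesgue_on I. hardy_integral I r x t < \<infinity>" "t \<in> I"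
  shows "hardy_integral I r x t < \<infinity>"
  using AE_I_ex_below[OF assms] hardy_integral_antimono[of _ t r x]
  by (meson less_imp_le order_le_less_trans)

lemma hardy_antimono:
  assumes "AE t in lebesgue_on I. hardy_integral I r x t < \<infinity>" "0 < r"
  shows "antimono_on I (hardy I r x)"
proof (rule monotone_onI)
  fix s t assume "s \<in> I" "t \<in> I" "s \<le> t"
  \<comment> \<open>Finiteness of the integral at \<open>s\<close> is essential:
    \<open>enn2real\<close> sends infinity to 0, which would destroy monotonicity.\<close>
  then show "hardy I r x s \<ge> hardy I r x t"
    unfolding hardy_def using assms(2) hardy_integral_antimono[of s t r x] hardy_integral_finite[OF assms(1)]
    by (intro powr_mono2 enn2real_mono) auto
qed

lemma hardy_nonneg: "0 \<le> hardy I r x t"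
  unfolding hardy_def by simp

text \<open>Only the product \<open>w\<close> is decreasing, so the estimate averages
  \<open>w\<close> rather than its factors. The functions \<open>f x\<close> and \<open>f y\<close>
  share the weight 1/s evenly, and their squares integrate to the two Hardy integrals from
  \<open>t / 2\<close> on. The average contributes 1/2, squaring makes it 1/4, and the final root of
  order r yields \<open>4 powr (1 / r)\<close>.\<close>

lemma decreasing_product_le_hardy:
  assumes r: "0 < r" and x: "x \<in> L0 I" and y: "y \<in> L0 I"
    and finx: "AE t in lebesgue_on I. hardy_integral I r x t < \<infinity>"
    and finy: "AE t in lebesgue_on I. hardy_integral I r y t < \<infinity>"
    and w: "antimono_on I w" "\<And>t. t \<in> I \<Longrightarrow> 0 \<le> w t" and eq: "AE t in lebesgue_on I. w t = x t * y t"
    and t: "t \<in> I"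
  shows "w t \<le> 4 powr (1 / r) * (D2 (hardy I r x) t * D2 (hardy I r y) t)"
proof -
  let ?J = "I \<inter> {t / 2<..}"
  let ?M = "lebesgue_on ?J"
  have t0: "0 < t" using I_pos t by blast
  have J: "?J \<in> sets lebesgue" "?J \<subseteq> I" by auto
  have [measurable]: "x \<in> borel_measurable ?M" "y \<in> borel_measurable ?M"
    using x y measurable_restrict_mono[OF _ J(2)] by blast+
  have [measurable]: "(\<lambda>s. s) \<in> borel_measurable ?M"
    by (intro measurable_restrict_space1 measurable_completion) simp
  define f where "f z s = ennreal (\<bar>z s\<bar> powr (r / 2) / sqrt s)" for z :: "real \<Rightarrow> real" and s
  have fm: "f x \<in> borel_measurable ?M" "f y \<in> borel_measurable ?M"
    unfolding f_def by measurable
  have half: "(a powr (r / 2))\<^sup>2 = a powr r" for a :: real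
    by (simp add: power2_eq_square flip: powr_add)
  have sq: "(\<integral>\<^sup>+s. (f z s)\<^sup>2 \<partial>?M) = hardy_integral I r z (t / 2)" for z
    unfolding hardy_integral_def
  proof (rule nn_integral_cong)
    fix s assume "s \<in> space ?M"
    then have s: "0 < s" using I_pos by auto
    have "(\<bar>z s\<bar> powr (r / 2) / sqrt s)\<^sup>2 = \<bar>z s\<bar> powr r / s"
      using s by (simp add: power_divide half)
    then show "(f z s)\<^sup>2 = ennreal (\<bar>z s\<bar> powr r / s)"
      unfolding f_def using s by (simp add: ennreal_power)
  qed
  have AEJ: "AE s in ?M. s \<in> ?J \<and> w s = x s * y s"
    using eq J by (auto simp: AE_restrict_space_iff)
  have sub: "{t / 2<..<t} \<subseteq> ?J" using I_down[OF t] t0 by auto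
  \<comment> \<open>On (t/2, t) the weight 1/s is at least 1/t, and this interval has length
    \<open>t / 2\<close>, hence the factor 1/2.\<close>
  have "ennreal (w t powr (r / 2) / 2) = ennreal (w t powr (r / 2) / t) * ennreal (t / 2)"
    using t0 by (simp flip: ennreal_mult)
  also have "\<dots> = ennreal (w t powr (r / 2) / t) * emeasure ?M {t / 2<..<t}"
    using sub J t0 by (simp add: emeasure_restrict_space)
  also have "\<dots> = (\<integral>\<^sup>+s. ennreal (w t powr (r / 2) / t) * indicator {t / 2<..<t} s \<partial>?M)"
    using sub J by (subst nn_integral_cmult_indicator) (auto simp: sets_restrict_space_iff)
  also have "\<dots> \<le> (\<integral>\<^sup>+s. f x s * f y s \<partial>?M)"
  proof (rule nn_integral_mono_AE)
    show "AE s in ?M. ennreal (w t powr (r / 2) / t) * indicator {t / 2<..<t} s \<le> f x s * f y s"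
      using AEJ
    proof eventually_elim
      case (elim s)
      show ?case
      proof (cases "s \<in> {t / 2<..<t}")
        case True
        then have s: "0 < s" "s \<in> I" "s \<le> t" using elim I_pos by auto
        have ws: "w t \<le> w s" using w(1) s t unfolding monotone_on_def by auto
        have "w t powr (r / 2) / t \<le> w s powr (r / 2) / s"
          using ws w(2)[OF t] s t0 r by (intro frac_le powr_mono2) auto
        also have "w s = \<bar>x s\<bar> * \<bar>y s\<bar>" using elim w(2)[OF s(2)] by (simp flip: abs_mult)
        also have "(\<bar>x s\<bar> * \<bar>y s\<bar>) powr (r / 2) / s = (\<bar>x s\<bar> powr (r / 2) / sqrt s) * (\<bar>y s\<bar> powr (r / 2) / sqrt s)"
          using s by (simp add: powr_mult)
        finally have "ennreal (w t powr (r / 2) / t) \<le>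
            ennreal ((\<bar>x s\<bar> powr (r / 2) / sqrt s) * (\<bar>y s\<bar> powr (r / 2) / sqrt s))"
          by (rule ennreal_leI)
        also have "\<dots> = f x s * f y s" unfolding f_def using s by (subst ennreal_mult) auto
        finally show ?thesis using True by simp
      qed simp
    qed
  qed
  finally have "(ennreal (w t powr (r / 2) / 2))\<^sup>2 \<le> (\<integral>\<^sup>+s. f x s * f y s \<partial>?M)\<^sup>2"
    by (rule power_mono) simp
  also have "\<dots> \<le> hardy_integral I r x (t / 2) * hardy_integral I r y (t / 2)"
    using Cauchy_Schwarz_nn_integral[OF fm] unfolding sq .
  finally have "ennreal ((w t powr (r / 2) / 2)\<^sup>2) \<le> hardy_integral I r x (t / 2) * hardy_integral I r y (t / 2)"
    by (simp add: ennreal_power)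
  moreover have "(w t powr (r / 2) / 2)\<^sup>2 = w t powr r / 4"
    by (simp add: power_divide half)
  ultimately have *: "ennreal (w t powr r / 4) \<le> hardy_integral I r x (t / 2) * hardy_integral I r y (t / 2)"
    by simp
  define p q where "p = enn2real (hardy_integral I r x (t / 2))" and "q = enn2real (hardy_integral I r y (t / 2))"
  have pq: "hardy_integral I r x (t / 2) = ennreal p" "hardy_integral I r y (t / 2) = ennreal q" "0 \<le> p" "0 \<le> q"
    using hardy_integral_finite[OF finx I_half[OF t]] hardy_integral_finite[OF finy I_half[OF t]]
    unfolding p_def q_def by simp_all
  have "w t powr r / 4 \<le> p * q"
    using * pq by (simp flip: ennreal_mult add: ennreal_le_iff)
  then have "w t powr r \<le> 4 * (p * q)" by simp
  then have "(w t powr r) powr (1 / r) \<le> (4 * (p * q)) powr (1 / r)"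
    using r by (intro powr_mono2) auto
  then have "w t \<le> (4 * (p * q)) powr (1 / r)"
    using r w(2)[OF t] by (simp add: powr_powr)
  also have "\<dots> = 4 powr (1 / r) * (p powr (1 / r) * q powr (1 / r))"
    using pq by (simp add: powr_mult)
  finally show ?thesis by (simp add: D2_def hardy_def p_def q_def)
qed

text \<open>
  Transplants a decreasing function \<open>h\<close> on \<open>I\<close> to a function of \<open>\<bar>u\<bar>\<close>. Taking the infimum of
  \<open>h\<close> over all points where \<open>u\<^sup>* \<ge> \<bar>u s\<bar>\<close> makes it constant on the plateaus of \<open>u\<^sup>*\<close>, so that no
  measure preserving map carrying \<open>u\<^sup>*\<close> to \<open>\<bar>u\<bar>\<close> is needed. The value \<open>0\<close> is used only on a null set.
\<close>

definition transplant :: "(real \<Rightarrow> real) \<Rightarrow> (real \<Rightarrow> real) \<Rightarrow> real \<Rightarrow> real" where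
  "transplant u h s =
     (if \<exists>t\<in>I. \<bar>u s\<bar> \<le> rearr I u t then INF t\<in>{t\<in>I. \<bar>u s\<bar> \<le> rearr I u t}. h t else 0)"

text \<open>The infimum grows with the value of \<open>\<bar>u s\<bar>\<close>, since fewer points
  compete. So the function is \<open>\<bar>u\<bar>\<close> followed by a map that is increasing on
  the interval \<open>A\<close> of values not above the whole rearrangement and is 0
  elsewhere.\<close>

lemma transplant_L0:
  assumes u: "u \<in> L0 I" and h: "\<And>t. t \<in> I \<Longrightarrow> 0 \<le> h t"
  shows "transplant u h \<in> L0 I"
proof -
  let ?T = "\<lambda>v. {t\<in>I. v \<le> rearr I u t}"
  define A where "A = {v. ?T v \<noteq> {}}"
  have A: "A \<in> sets borel"
  proof (rule real_interval_borel_measurable)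
    show "is_interval A" unfolding is_interval_1 A_def by force
  qed
  have "mono_on A (\<lambda>v. INF t\<in>?T v. h t)"
  proof (rule mono_onI)
    fix v v' assume "v \<in> A" "v' \<in> A" "v \<le> v'"
    then show "(INF t\<in>?T v. h t) \<le> (INF t\<in>?T v'. h t)"
      using h by (intro cINF_superset_mono) (auto simp: A_def intro!: bdd_belowI2[of _ 0])
  qed
  then have "(\<lambda>v. INF t\<in>?T v. h t) \<in> borel_measurable (restrict_space borel A)"
    by (rule borel_measurable_mono_on_fnc)
  then have [measurable]: "(\<lambda>v. indicator A v *\<^sub>R (INF t\<in>?T v. h t)) \<in> borel_measurable borel"
    using A by (simp add: borel_measurable_restrict_space_iff)
  have [measurable]: "u \<in> L0 I" by fact
  have "(\<lambda>s. indicator A \<bar>u s\<bar> *\<^sub>R (INF t\<in>?T \<bar>u s\<bar>. h t)) \<in> L0 I"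
    by (rule measurable_compose[of "\<lambda>s. \<bar>u s\<bar>" _ borel]) measurable
  moreover have "transplant u h = (\<lambda>s. indicator A \<bar>u s\<bar> *\<^sub>R (INF t\<in>?T \<bar>u s\<bar>. h t))"
    by (rule ext) (auto simp: transplant_def A_def indicator_def)
  ultimately show ?thesis by simp
qed

lemma transplant_nonneg:
  assumes h: "\<And>t. t \<in> I \<Longrightarrow> 0 \<le> h t"
  shows "0 \<le> transplant u h s"
  unfolding transplant_def using h by (auto intro!: cINF_greatest)

text \<open>Wherever \<open>\<bar>u s\<bar>\<close> is at most the rearrangement of \<open>u\<close>
  at \<open>t\<close>, the point \<open>t\<close> competes in the infimum, so the transplant is at
  most \<open>h t\<close>. The exceptional points form a set of measure at most
  \<open>t\<close>.\<close>

lemma rearr_transplant: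
  assumes u: "u \<in> L0 I" "\<And>t. t \<in> I \<Longrightarrow> rearrangement I u t < \<infinity>" and h: "\<And>t. t \<in> I \<Longrightarrow> 0 \<le> h t" and t: "t \<in> I"
  shows "rearrangement I (transplant u h) t < \<infinity>" "rearr I (transplant u h) t \<le> h t"
proof -
  have "emeasure (lebesgue_on I) {s\<in>I. h t < \<bar>transplant u h s\<bar>} \<le> emeasure (lebesgue_on I) {s\<in>I. rearr I u t < \<bar>u s\<bar>}"
  proof (intro emeasure_mono superlevel_sets u(1) subsetI CollectI conjI)
    fix s assume s: "s \<in> {s\<in>I. h t < \<bar>transplant u h s\<bar>}"
    then show "s \<in> I" by simp
    show "rearr I u t < \<bar>u s\<bar>"
    proof (rule ccontr)
      assume "\<not> ?thesis"
      then have tT: "t \<in> {t\<in>I. \<bar>u s\<bar> \<le> rearr I u t}" using t by simp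
      then have "transplant u h s = (INF t\<in>{t\<in>I. \<bar>u s\<bar> \<le> rearr I u t}. h t)"
        unfolding transplant_def by auto
      also have "\<dots> \<le> h t"
        using tT h by (intro cINF_lower) (auto intro!: bdd_belowI2[of _ 0])
      finally show False using s transplant_nonneg[of h u s] h by simp
    qed
  qed
  also have "\<dots> \<le> ennreal t" by (rule emeasure_superlevel_rearr[OF u(1) u(2)[OF t]])
  finally have "emeasure (lebesgue_on I) {s\<in>I. h t < \<bar>transplant u h s\<bar>} \<le> ennreal t" .
  from rearr_leI[OF transplant_L0[OF u(1) h] h[OF t] this]
  show "rearrangement I (transplant u h) t < \<infinity>" "rearr I (transplant u h) t \<le> h t" by blast+
qed

text \<open>The two infima run over the same set of points. For competitors \<open>a\<close> and
  \<open>b\<close> the larger one competes as well, and there both \<open>h\<close> and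
  \<open>k\<close> are smallest; thus \<open>h a * k b\<close> dominates
  \<open>\<bar>u s\<bar>\<close> for independent \<open>a\<close> and \<open>b\<close>, and the
  infima can be taken separately.\<close>

lemma le_transplant_mult:
  assumes u: "u \<in> L0 I" "\<And>t. t \<in> I \<Longrightarrow> rearrangement I u t < \<infinity>"
    and h: "antimono_on I h" "\<And>t. t \<in> I \<Longrightarrow> 0 \<le> h t"
    and k: "antimono_on I k" "\<And>t. t \<in> I \<Longrightarrow> 0 \<le> k t"
    and le: "\<And>t. t \<in> I \<Longrightarrow> rearr I u t \<le> h t * k t"
  shows "AE s in lebesgue_on I. \<bar>u s\<bar> \<le> transplant u h s * transplant u k s"
proof -
  \<comment> \<open>Outside \<open>N\<close> some point competes, so the default value of
    \<open>transplant\<close> does not occur. The sequence starts at 1/2 because 1 does not belong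
    to (0, 1).\<close>
  define N where "N = (\<Inter>n. {s\<in>I. rearr I u (1 / real (Suc (Suc n))) < \<bar>u s\<bar>})"
  have In: "1 / real (Suc (Suc n)) \<in> I" for n using I_cases by auto
  have NS: "N \<in> sets (lebesgue_on I)"
    unfolding N_def using superlevel_sets[OF u(1)] by (intro sets.countable_INT) auto
  have "emeasure (lebesgue_on I) N \<le> ennreal (1 / real (Suc (Suc n)))" for n
  proof -
    have "emeasure (lebesgue_on I) N \<le> emeasure (lebesgue_on I) {s\<in>I. rearr I u (1 / real (Suc (Suc n))) < \<bar>u s\<bar>}"
      by (intro emeasure_mono superlevel_sets u(1)) (auto simp: N_def)
    also have "\<dots> \<le> ennreal (1 / real (Suc (Suc n)))"
      by (rule emeasure_superlevel_rearr[OF u(1) u(2)[OF In]])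
    finally show ?thesis .
  qed
  moreover have "(\<lambda>n. ennreal (1 / real (Suc (Suc n)))) \<longlonglongrightarrow> 0"
  proof -
    have "(\<lambda>n. 1 / real (Suc (Suc n))) \<longlonglongrightarrow> 0"
      using LIMSEQ_Suc[OF LIMSEQ_inverse_real_of_nat] by (simp add: divide_inverse)
    then show ?thesis using tendsto_ennrealI by fastforce
  qed
  ultimately have "emeasure (lebesgue_on I) N \<le> 0"
    by (intro LIMSEQ_le_const) auto
  then have "emeasure (lebesgue_on I) N = 0" by simp
  moreover have "\<bar>u s\<bar> \<le> transplant u h s * transplant u k s" if s: "s \<in> I" "s \<notin> N" for s
  proof -
    let ?T = "{t\<in>I. \<bar>u s\<bar> \<le> rearr I u t}"
    have ne: "?T \<noteq> {}" using s In unfolding N_def by (auto simp: not_less)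
    have *: "\<bar>u s\<bar> \<le> h a * k b" if "a \<in> ?T" "b \<in> ?T" for a b
    proof -
      define c where "c = max a b"
      have c: "c \<in> ?T" "a \<le> c" "b \<le> c" using that unfolding c_def by (auto simp: max_def)
      have "\<bar>u s\<bar> \<le> h c * k c" using le[of c] c by auto
      also have "\<dots> \<le> h a * k b"
        using c that h k unfolding monotone_on_def by (intro mult_mono) auto
      finally show ?thesis .
    qed
    have "\<bar>u s\<bar> \<le> Inf (h ` ?T) * k b" if "b \<in> ?T" for b
      by (rule le_cInf_mult) (use ne * that k in auto)
    moreover have "0 \<le> Inf (h ` ?T)" using ne h by (intro cINF_greatest) auto
    ultimately have "\<bar>u s\<bar> \<le> Inf (k ` ?T) * Inf (h ` ?T)"
      using ne by (intro le_cInf_mult) (auto simp: mult.commute)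
    moreover have "\<exists>t\<in>I. \<bar>u s\<bar> \<le> rearr I u t" using ne by blast
    ultimately show ?thesis unfolding transplant_def by (simp add: mult.commute)
  qed
  ultimately show ?thesis using NS by (intro AE_I[where N = N]) auto
qed

section \<open>The second inclusion\<close>

lemma transplant_symmetrization:
  assumes E: "solid_space I E"
    and u: "u \<in> L0 I" "\<And>t. t \<in> I \<Longrightarrow> rearrangement I u t < \<infinity>"
    and h: "h \<in> elems E" "\<And>t. t \<in> I \<Longrightarrow> 0 \<le> h t"
  shows "transplant u h \<in> elems (symmetrization I E)"
    "qnorm (symmetrization I E) (transplant u h) \<le> qnorm E h"
proof -
  have r: "rearrangement I (transplant u h) t < \<infinity>" "rearr I (transplant u h) t \<le> h t" if "t \<in> I" for t
    by (rule rearr_transplant[OF u(1)]; use u(2) h(2) that in blast)+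
  have fin: "\<forall>t\<in>I. rearrangement I (transplant u h) t < \<infinity>" using r(1) by blast
  have m: "rearr I (transplant u h) \<in> L0 I" using fin by (intro rearr_L0 AE_I2) simp
  have "AE t in lebesgue_on I. \<bar>rearr I (transplant u h) t\<bar> \<le> \<bar>h t\<bar>"
  proof (rule AE_I2)
    fix t assume "t \<in> space (lebesgue_on I)"
    then show "\<bar>rearr I (transplant u h) t\<bar> \<le> \<bar>h t\<bar>"
      using r(2)[of t] rearr_nonneg[of "transplant u h" t] by simp
  qed
  note i = solid_space_ideal[OF E h(1) m this]
  show "transplant u h \<in> elems (symmetrization I E)"
    unfolding symmetrization_iff using transplant_L0[of u h] u(1) h(2) fin i(1) by blast
  show "qnorm (symmetrization I E) (transplant u h) \<le> qnorm E h"
    unfolding qnorm_symmetrization by (rule i(2))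
qed

lemma D2_hardy:
  assumes E: "solid_space I E" and A: "D2_bound I E A" and C: "hardy_bound I r E C" and r: "0 < r"
    and x: "x \<in> elems E"
  shows "D2 (hardy I r x) \<in> elems E" "qnorm E (D2 (hardy I r x)) \<le> A * C * qnorm E x"
    "antimono_on I (D2 (hardy I r x))"
proof -
  have fin: "AE t in lebesgue_on I. hardy_integral I r x t < \<infinity>" and h: "hardy I r x \<in> elems E"
    and le: "qnorm E (hardy I r x) \<le> C * qnorm E x"
    using C x unfolding hardy_bound_def by blast+
  have anti: "antimono_on I (hardy I r x)" by (rule hardy_antimono[OF fin r])
  note D = D2_bound_decreasing[OF A anti hardy_nonneg h]
  show "D2 (hardy I r x) \<in> elems E" by (rule D)
  have "1 \<le> A" using A unfolding D2_bound_def by blast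
  then have "A * qnorm E (hardy I r x) \<le> A * (C * qnorm E x)" using le by (intro mult_left_mono) auto
  then show "qnorm E (D2 (hardy I r x)) \<le> A * C * qnorm E x" using D(2) by (simp add: mult.assoc)
  show "antimono_on I (D2 (hardy I r x))"
    using anti I_half unfolding monotone_on_def D2_def by auto
qed

lemma symmetrization_of_product:
  assumes E: "solid_space I E" and F: "solid_space I F"
    and A: "D2_bound I E A" and B: "D2_bound I F B"
    and C: "hardy_bound I r E C" and D: "hardy_bound I r F D" and r: "0 < r"
  shows "embeds_with (symmetrization I (product_space I E F))
    (product_space I (symmetrization I E) (symmetrization I F)) (4 powr (1 / r) * (A * C) * (B * D))"
  unfolding embeds_with_def
proof (intro conjI subsetI ballI)
  let ?SE = "symmetrization I E" and ?SF = "symmetrization I F"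
  let ?P = "product_space I ?SE ?SF" and ?S = "symmetrization I (product_space I E F)"
  let ?M = "4 powr (1 / r) * (A * C) * (B * D)"
  note SE = symmetrization_solid[OF E] and SF = symmetrization_solid[OF F]
  have pos: "0 \<le> A" "0 \<le> B" "0 \<le> C" "0 \<le> D"
    using A B C D unfolding D2_bound_def hardy_bound_def by linarith+
  fix u assume "u \<in> elems ?S"
  then have u: "u \<in> L0 I" "\<And>t. t \<in> I \<Longrightarrow> rearrangement I u t < \<infinity>"
    and ru: "rearr I u \<in> elems (product_space I E F)"
    unfolding symmetrization_iff by blast+
  have *: "u \<in> elems ?P \<and> qnorm ?P u \<le> ?M * a" if a: "qnorm ?S u < a" for a
  proof -
    have a': "qnorm (product_space I E F) (rearr I u) < a" using a unfolding qnorm_symmetrization .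
    obtain x y where xy: "x \<in> elems E" "y \<in> elems F" "AE t in lebesgue_on I. rearr I u t = x t * y t"
      "qnorm E x \<le> sqrt a" "qnorm F y \<le> sqrt a"
      using product_space_factor[OF E F ru a'] .
    have a0: "0 < a" using product_space_nonneg[OF E F ru] a' by simp
    note Dx = D2_hardy[OF E A C r xy(1)] and Dy = D2_hardy[OF F B D r xy(2)]
    have finx: "AE t in lebesgue_on I. hardy_integral I r x t < \<infinity>"
      and finy: "AE t in lebesgue_on I. hardy_integral I r y t < \<infinity>"
      using C D xy(1,2) unfolding hardy_bound_def by blast+
    \<comment> \<open>The whole constant is put on one factor; only the product of the two
      matters.\<close>
    define h where "h t = 4 powr (1 / r) * D2 (hardy I r x) t" for t
    define k where "k = D2 (hardy I r y)"
    have hk0: "0 \<le> h t" "0 \<le> k t" for t by (simp_all add: h_def k_def D2_def hardy_nonneg)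
    have h: "h \<in> elems E" "qnorm E h \<le> 4 powr (1 / r) * (A * C * qnorm E x)"
      using solid_space_scale[OF E Dx(1), of "4 powr (1 / r)"] Dx(2) unfolding h_def
      by (simp_all add: mult_left_mono)
    have ha: "antimono_on I h"
      using Dx(3) unfolding monotone_on_def h_def by (auto intro: mult_left_mono)
    have k: "k \<in> elems F" "qnorm F k \<le> B * D * qnorm F y" "antimono_on I k"
      using Dy unfolding k_def by blast+
    have le: "rearr I u t \<le> h t * k t" if "t \<in> I" for t
    proof -
      have "antimono_on I (rearr I u)" using u(2) by (rule antimono_on_rearr)
      from decreasing_product_le_hardy[OF r solid_space_L0[OF E xy(1)] solid_space_L0[OF F xy(2)]
          finx finy this rearr_nonneg xy(3) that]
      show ?thesis by (simp add: h_def k_def mult.assoc)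
    qed
    have "AE s in lebesgue_on I. \<bar>u s\<bar> \<le> transplant u h s * transplant u k s"
      by (rule le_transplant_mult[OF u(1) _ ha _ k(3)]) (use u(2) hk0 le in blast)+
    then have AEu: "AE s in lebesgue_on I. \<bar>u s\<bar> \<le> \<bar>transplant u h s\<bar> * \<bar>transplant u k s\<bar>"
      using transplant_nonneg[of h u] transplant_nonneg[of k u] hk0 by simp
    have th: "transplant u h \<in> elems ?SE" "qnorm ?SE (transplant u h) \<le> qnorm E h"
      by (rule transplant_symmetrization[OF E u(1)]; use u(2) hk0(1) h(1) in blast)+
    have tk: "transplant u k \<in> elems ?SF" "qnorm ?SF (transplant u k) \<le> qnorm F k"
      by (rule transplant_symmetrization[OF F u(1)]; use u(2) hk0(2) k(1) in blast)+
    note pl = product_space_le[OF SE SF th(1) tk(1) u(1) AEu]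
    have "qnorm ?SE (transplant u h) \<le> 4 powr (1 / r) * (A * C) * sqrt a"
    proof -
      have "A * C * qnorm E x \<le> A * C * sqrt a" using xy(4) pos by (intro mult_left_mono) auto
      then have "4 powr (1 / r) * (A * C * qnorm E x) \<le> 4 powr (1 / r) * (A * C * sqrt a)"
        by (rule mult_left_mono) simp
      then show ?thesis using th(2) h(2) unfolding mult.assoc by linarith
    qed
    moreover have "qnorm ?SF (transplant u k) \<le> B * D * sqrt a"
    proof -
      have "B * D * qnorm F y \<le> B * D * sqrt a" using xy(5) pos by (intro mult_left_mono) auto
      then show ?thesis using tk(2) k(2) by simp
    qed
    ultimately have "qnorm ?SE (transplant u h) * qnorm ?SF (transplant u k) \<le>
        (4 powr (1 / r) * (A * C) * sqrt a) * (B * D * sqrt a)"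
      using pos a0 solid_space_nonneg[OF SF tk(1)] by (intro mult_mono) auto
    also have "\<dots> = ?M * (sqrt a * sqrt a)" by (simp only: mult_ac)
    also have "\<dots> = ?M * a" using a0 by simp
    finally show ?thesis using pl by simp
  qed
  show "u \<in> elems ?P" using *[OF less_add_one] by blast
  show "qnorm ?P u \<le> ?M * qnorm ?S u"
  \<comment> \<open>A Hardy bound may be 0, and then so is \<open>?M\<close>; dividing by
    \<open>?M + 1\<close> keeps the slack well defined.\<close>
  proof (rule field_le_epsilon)
    fix e :: real assume e: "0 < e"
    have M: "0 \<le> ?M" using pos by simp
    have "qnorm ?P u \<le> ?M * (qnorm ?S u + e / (?M + 1))"
      using *[of "qnorm ?S u + e / (?M + 1)"] e M by simp
    also have "\<dots> = ?M * qnorm ?S u + e * (?M / (?M + 1))" by (simp add: distrib_left)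
    also have "\<dots> \<le> ?M * qnorm ?S u + e * 1"
      using e M by (intro add_left_mono mult_left_mono) auto
    finally show "qnorm ?P u \<le> ?M * qnorm ?S u + e" by simp
  qed
qed

end

section \<open>Calderon constants and equivalence of the quasi-norms\<close>

theorem corollary2:
  fixes I :: "real set" and E F :: fspace
  assumes "I = {0<..<1} \<or> I = {0<..}"
    and "quasi_Banach_ideal_space I E" and "quasi_Banach_ideal_space I F"
    and "elems (symmetrization I E) \<noteq> null_class I"
    and "elems (symmetrization I F) \<noteq> null_class I"
    and "D2_bounded I E" and "D2_bounded I F"
  defines "SE \<equiv> symmetrization I E" and "SF \<equiv> symmetrization I F"
  defines "P \<equiv> product_space I SE SF"
    and "SP \<equiv> symmetrization I (product_space I E F)"
    and "K \<equiv> calderon_half I SE SF"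
    and "SK \<equiv> symmetrization I (calderon_half I E F)"
  shows
    "elems P \<noteq> null_class I \<and>
     elems P \<subseteq> elems SP \<and>
     (\<exists>C1. C1 \<le> max (D2_const I E) (D2_const I F) \<and> embeds_with K SK C1) \<and>
     (\<forall>C1. C1 \<le> max (D2_const I E) (D2_const I F) \<and> embeds_with K SK C1 \<longrightarrow>
        (\<forall>x\<in>elems P. qnorm SP x \<le> C1\<^sup>2 * qnorm P x)) \<and>
     (\<forall>r>0. hardy_bounded I r E \<and> hardy_bounded I r F \<longrightarrow>
        (let B = 2 powr (1 / r) * max 1 (2 powr (1 / r - 1)) *
                 max (D2_const I E * hardy_norm I r E) (D2_const I F * hardy_norm I r F)
         in elems SP \<subseteq> elems P \<and>
            (\<exists>C2. C2 \<le> B \<and> embeds_with SK K C2) \<and>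
            (\<forall>C2. C2 \<le> B \<and> embeds_with SK K C2 \<longrightarrow>
               (\<forall>x\<in>elems SP. qnorm P x \<le> C2\<^sup>2 * qnorm SP x)) \<and>
            quasi_normed_space I SP \<and>
            equal_with_equivalent_qnorms SP P))"
proof -
  interpret half_line_interval I by unfold_locales (rule assms(1))
  have nE: "quasi_normed_ideal_space I E" and nF: "quasi_normed_ideal_space I F"
    using assms(2,3) unfolding quasi_Banach_ideal_space_def by blast+
  note E = quasi_normed_ideal_space_solid[OF nE] and F = quasi_normed_ideal_space_solid[OF nF]
  have sE: "solid_space I SE" and sF: "solid_space I SF"
    unfolding SE_def SF_def using symmetrization_solid E F by blast+
  have sEF: "solid_space I (product_space I E F)"
    by (rule product_space_solid[OF assms(2,3)])
  have sSP: "solid_space I SP" unfolding SP_def by (rule symmetrization_solid[OF sEF])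
  define A B where "A = D2_const I E" and "B = D2_const I F"
  have A: "D2_bound I E A" and B: "D2_bound I F B"
    unfolding A_def B_def using D2_const_bound[OF E assms(6)] D2_const_bound[OF F assms(7)] .
  have AB: "1 \<le> A" "1 \<le> B" using A B unfolding D2_bound_def by blast+
  have PSP: "embeds_with P SP (A * B)"
    unfolding P_def SP_def SE_def SF_def by (rule product_of_symmetrizations[OF E F A B])
  have K: "square_root_of I K P"
    unfolding K_def P_def by (rule calderon_half_square_root[OF sE sF])
  have SK: "square_root_of I SK SP"
    unfolding SK_def SP_def by (rule symmetrization_square_root[OF calderon_half_square_root[OF E F]])
  have sqrt_le_max: "sqrt (a * b) \<le> max a b" if "0 \<le> a" "0 \<le> b" for a b :: real
  proof -
    have "sqrt (a * b) \<le> sqrt (max a b * max a b)"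
      using that by (intro real_sqrt_le_mono mult_mono) auto
    then show ?thesis using that by simp
  qed
  have Pabs: "u \<in> L0 I" "(\<lambda>t. \<bar>u t\<bar>) \<in> elems P" "qnorm P (\<lambda>t. \<bar>u t\<bar>) = qnorm P u" if "u \<in> elems P" for u
    using that product_space_L0 product_space_abs[OF sE sF] unfolding P_def by blast+
  have SPabs: "u \<in> L0 I" "(\<lambda>t. \<bar>u t\<bar>) \<in> elems SP" "qnorm SP (\<lambda>t. \<bar>u t\<bar>) = qnorm SP u" if "u \<in> elems SP" for u
  proof -
    show u[measurable]: "u \<in> L0 I" using solid_space_L0[OF sSP that] .
    have m: "(\<lambda>t. \<bar>u t\<bar>) \<in> L0 I" by measurable
    have eq: "AE t in lebesgue_on I. \<bar>\<bar>u t\<bar>\<bar> = \<bar>u t\<bar>" by simp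
    show "(\<lambda>t. \<bar>u t\<bar>) \<in> elems SP" "qnorm SP (\<lambda>t. \<bar>u t\<bar>) = qnorm SP u"
      by (rule solid_space_cong[OF sSP that m eq])+
  qed
  have Ppos: "0 \<le> qnorm P u" if "u \<in> elems P" for u
    using product_space_nonneg[OF sE sF] that unfolding P_def by blast
  have SPpos: "0 \<le> qnorm SP u" if "u \<in> elems SP" for u using solid_space_nonneg[OF sSP that] .
  have sub: "elems P \<subseteq> elems SP" using PSP unfolding embeds_with_def by blast

  have "elems P \<noteq> null_class I"
    unfolding P_def SE_def SF_def by (rule product_of_symmetrizations_nontrivial[OF E F assms(4,5)])
  moreover have "\<exists>C1. C1 \<le> max A B \<and> embeds_with K SK C1"
  proof (intro exI conjI)
    \<comment> \<open>The product estimate holds with \<open>A * B\<close>, so its root, the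
      geometric mean, serves for the Calderon products and lies below the maximum.\<close>
    show "sqrt (A * B) \<le> max A B" using sqrt_le_max AB by simp
    show "embeds_with K SK (sqrt (A * B))"
      by (rule square_root_embeds[OF K SK]) (use PSP AB in simp_all)
  qed
  moreover have "qnorm SP x \<le> C\<^sup>2 * qnorm P x" if C: "embeds_with K SK C" and x: "x \<in> elems P" for C x
    using embeds_square[OF K SK C Pabs(1,2)[OF x] Ppos[OF Pabs(2)[OF x]] SPpos] Pabs(3)[OF x] SPabs(3) x sub
    by (metis subsetD)
  moreover have "let B = 2 powr (1 / r) * max 1 (2 powr (1 / r - 1)) *
                 max (D2_const I E * hardy_norm I r E) (D2_const I F * hardy_norm I r F)
         in elems SP \<subseteq> elems P \<and>
            (\<exists>C2. C2 \<le> B \<and> embeds_with SK K C2) \<and>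
            (\<forall>C2. C2 \<le> B \<and> embeds_with SK K C2 \<longrightarrow>
               (\<forall>x\<in>elems SP. qnorm P x \<le> C2\<^sup>2 * qnorm SP x)) \<and>
            quasi_normed_space I SP \<and>
            equal_with_equivalent_qnorms SP P"
    if r: "0 < r" and H: "hardy_bounded I r E" "hardy_bounded I r F" for r
  proof -
    define C D where "C = hardy_norm I r E" and "D = hardy_norm I r F"
    have C: "hardy_bound I r E C" and D: "hardy_bound I r F D"
      unfolding C_def D_def using hardy_norm_bound[OF E H(1)] hardy_norm_bound[OF F H(2)] .
    have CD: "0 \<le> C" "0 \<le> D" using C D unfolding hardy_bound_def by blast+
    define M where "M = 4 powr (1 / r) * (A * C) * (B * D)"
    have M0: "0 \<le> M" unfolding M_def using AB CD by simp
    have SPP: "embeds_with SP P M"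
      unfolding P_def SP_def SE_def SF_def M_def by (rule symmetrization_of_product[OF E F A B C D r])
    have eq: "elems SP = elems P" using sub SPP unfolding embeds_with_def by blast
    have le: "qnorm P x \<le> M * qnorm SP x" "qnorm SP x \<le> A * B * qnorm P x" if "x \<in> elems SP" for x
      using that eq SPP PSP unfolding embeds_with_def by blast+
    let ?B = "2 powr (1 / r) * max 1 (2 powr (1 / r - 1)) * max (A * C) (B * D)"
    have "\<exists>C2. C2 \<le> ?B \<and> embeds_with SK K C2"
    proof (intro exI conjI)
      \<comment> \<open>The passage to Calderon products halves the exponent, which turns the 4 of
        the product estimate into the 2 of the claimed bound.\<close>
      have "4 powr (1 / r) = (2 powr (1 / r))\<^sup>2"
        by (simp add: powr_power power2_eq_square flip: powr_mult)
      then have "sqrt M = 2 powr (1 / r) * sqrt ((A * C) * (B * D))"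
        unfolding M_def by (simp add: real_sqrt_mult mult.assoc)
      also have "\<dots> \<le> 2 powr (1 / r) * (max 1 (2 powr (1 / r - 1)) * max (A * C) (B * D))"
      proof (rule mult_left_mono)
        have m: "0 \<le> max (A * C) (B * D)" using AB CD by (simp add: le_max_iff_disj)
        have "sqrt ((A * C) * (B * D)) \<le> 1 * max (A * C) (B * D)"
          using sqrt_le_max[of "A * C" "B * D"] AB CD by simp
        \<comment> \<open>This factor is at least 1, so inserting it only enlarges a nonnegative
          bound.\<close>
        also have "\<dots> \<le> max 1 (2 powr (1 / r - 1)) * max (A * C) (B * D)"
          using m by (intro mult_right_mono) auto
        finally show "sqrt ((A * C) * (B * D)) \<le> \<dots>" .
      qed simp
      finally show "sqrt M \<le> ?B" by (simp add: mult.assoc)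
      show "embeds_with SK K (sqrt M)"
        by (rule square_root_embeds[OF SK K]) (use SPP M0 in simp_all)
    qed
    moreover have "qnorm P x \<le> C2\<^sup>2 * qnorm SP x" if C2: "embeds_with SK K C2" and x: "x \<in> elems SP" for C2 x
      using embeds_square[OF SK K C2 SPabs(1,2)[OF x] SPpos[OF SPabs(2)[OF x]] Ppos] SPabs(3)[OF x] Pabs(3) x eq
      by metis
    moreover have "quasi_normed_space I SP"
    proof -
      obtain K1 where K1: "quasi_triangle E K1" using quasi_normed_ideal_space_triangle[OF nE] by blast
      obtain K2 where K2: "quasi_triangle F K2" using quasi_normed_ideal_space_triangle[OF nF] by blast
      define L where "L = 2 * (K1 * A) * (K2 * B)"
      have L: "quasi_triangle P L"
        unfolding P_def L_def SE_def SF_def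
        by (intro product_space_triangle symmetrization_solid symmetrization_triangle E F A B K1 K2)
      have L1: "1 \<le> L" using L unfolding quasi_triangle_def by blast
      \<comment> \<open>A sum is estimated by going to \<open>P\<close> at cost \<open>M\<close>,
        adding there at cost \<open>L\<close>, and returning at cost \<open>A * B\<close>. The
        maximum with 1 is taken because \<open>M\<close> may be small or 0, while a triangle
        constant is at least 1.\<close>
      have "quasi_triangle SP (max 1 (A * B * L * M))"
        unfolding quasi_triangle_def
      proof (intro conjI ballI)
        fix x y assume x: "x \<in> elems SP" and y: "y \<in> elems SP"
        then have xy: "(\<lambda>t. x t + y t) \<in> elems P" "qnorm P (\<lambda>t. x t + y t) \<le> L * (qnorm P x + qnorm P y)"
          using L eq unfolding quasi_triangle_def by blast+
        then show "(\<lambda>t. x t + y t) \<in> elems SP" using eq by blast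
        have "qnorm SP (\<lambda>t. x t + y t) \<le> A * B * qnorm P (\<lambda>t. x t + y t)"
          using le(2) xy(1) eq by blast
        also have "\<dots> \<le> A * B * (L * (qnorm P x + qnorm P y))"
          using xy(2) AB by (intro mult_left_mono) auto
        also have "\<dots> \<le> A * B * (L * (M * qnorm SP x + M * qnorm SP y))"
          using le(1) x y AB L1 by (intro mult_left_mono add_mono) auto
        also have "\<dots> = A * B * L * M * (qnorm SP x + qnorm SP y)" by (simp add: algebra_simps)
        also have "\<dots> \<le> max 1 (A * B * L * M) * (qnorm SP x + qnorm SP y)"
          using SPpos x y by (intro mult_right_mono add_nonneg_nonneg) auto
        finally show "qnorm SP (\<lambda>t. x t + y t) \<le> max 1 (A * B * L * M) * (qnorm SP x + qnorm SP y)" .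
      qed simp
      then show ?thesis by (rule solid_space_quasi_normed[OF sSP])
    qed
    moreover have "equal_with_equivalent_qnorms SP P"
      unfolding equal_with_equivalent_qnorms_def
    proof (intro conjI exI ballI)
      \<comment> \<open>\<open>M\<close> may be 0, and constants of equivalence must be positive,
        hence \<open>M + 1\<close>.\<close>
      show "0 < 1 / (A * B)" "0 < M + 1" using AB M0 by simp_all
      fix x assume x: "x \<in> elems SP"
      show "1 / (A * B) * qnorm SP x \<le> qnorm P x"
        using le(2)[OF x] AB by (simp add: divide_le_eq mult.commute)
      show "qnorm P x \<le> (M + 1) * qnorm SP x"
        using le(1)[OF x] SPpos[OF x] by (simp add: distrib_right)
    qed (rule eq)
    ultimately show ?thesis
      unfolding Let_def A_def[symmetric] B_def[symmetric] C_def[symmetric] D_def[symmetric]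
      using eq by blast
  qed
  ultimately show ?thesis
    unfolding A_def[symmetric] B_def[symmetric] using sub by blast
qed

end
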